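(* For all $n \geq 0$, $$p_{\xi}(3n) \equiv \begin{cases} 1 \pmod{8}, & \text{if } n=0,\\ 6(-1)^k \pmod{8}, & \text{if } n=k^2 \text{ with } k\ge1,\\ 4 \pmod{8}, & \text{if } n = 2k^2,\ n = 3k^2, \text{ or } n = 6k^2 \text{ with } k\ge 1,\\ 0 \pmod{8}, & \text{otherwise}.\end{cases}$$
   Context: $(a;q)_n=(1-a)(1-aq)\cdots(1-aq^{n-1})$, $(a;q)_0=1$. The coefficients $p_\xi(n)$ are defined by $\sum_{n\ge0}p_\xi(n)q^n=\xi(q)=1+2\sum_{n\ge1}\frac{q^{6n^2-6n+1}}{(q;q^6)_n(q^5;q^6)_n}$. *)

theory Defs
  imports "HOL-Number_Theory.Number_Theory" "HOL-Computational_Algebra.Computational_Algebra"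
begin

definition q_pochhammer :: "'a::comm_ring_1 \<Rightarrow> 'a \<Rightarrow> nat \<Rightarrow> 'a" where
  "q_pochhammer a q n = (\<Prod>i<n. 1 - a * q ^ i)"

text \<open>
  All series are formal power series in \<open>q = fps_X\<close> over the integers. Since \<^typ>\<open>int\<close> has no
  \<open>inverse\<close>, the reciprocal of a series with constant coefficient 1 is the library's
  \<open>fps_right_inverse f 1\<close>; see \<open>xi_denom_inverse\<close> below.
\<close>

definition xi_denom :: "nat \<Rightarrow> int fps" where
  "xi_denom n = q_pochhammer fps_X (fps_X ^ 6) n * q_pochhammer (fps_X ^ 5) (fps_X ^ 6) n"

definition xi_term :: "nat \<Rightarrow> int fps" where
  "xi_term n = fps_X ^ (6 * n ^ 2 - 6 * n + 1) * fps_right_inverse (xi_denom n) 1"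

text \<open>
  The infinite sum is taken in the usual topology on formal power series, in which it converges
  (\<open>summable_xi_term\<close> below). The shift to \<open>Suc n\<close> makes it start at index 1, where the
  natural-number subtraction in the exponent does not truncate.
\<close>

definition xi :: "int fps" where
  "xi = 1 + 2 * (\<Sum>n. xi_term (Suc n))"

definition p_xi :: "nat \<Rightarrow> int" where
  "p_xi n = fps_nth xi n"

lemma xi_denom_nth_0: "fps_nth (xi_denom n) 0 = 1"
proof -
  have "fps_nth (\<Prod>i<n. 1 - fps_X * (fps_X ^ 6) ^ i :: int fps) 0 = 1"
    by (induction n) auto
  moreover have "fps_nth (\<Prod>i<n. 1 - fps_X ^ 5 * (fps_X ^ 6) ^ i :: int fps) 0 = 1"
    by (induction n) auto
  ultimately show ?thesis
    by (simp add: xi_denom_def q_pochhammer_def)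
qed

lemma xi_denom_inverse: "xi_denom n * fps_right_inverse (xi_denom n) 1 = 1"
  by (rule fps_right_inverse) (simp add: xi_denom_nth_0)

lemma xi_term_nth_eq_0:
  assumes "m < n"
  shows "fps_nth (xi_term (Suc n)) m = 0"
proof -
  have "6 * Suc n ^ 2 - 6 * Suc n + 1 = 6 * n ^ 2 + 6 * n + 1"
    by (simp add: power2_eq_square)
  hence "m < 6 * Suc n ^ 2 - 6 * Suc n + 1"
    using assms by linarith
  thus ?thesis
    by (simp add: xi_term_def fps_X_power_mult_nth del: One_nat_def)
qed

lemma xi_term_sums:
  "(\<lambda>n. xi_term (Suc n)) sums Abs_fps (\<lambda>m. \<Sum>n\<le>m. fps_nth (xi_term (Suc n)) m)"
  unfolding sums_def
proof (rule tendsto_fpsI)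
  fix m
  show "eventually (\<lambda>N. fps_nth (\<Sum>n<N. xi_term (Suc n)) m =
      fps_nth (Abs_fps (\<lambda>m. \<Sum>n\<le>m. fps_nth (xi_term (Suc n)) m)) m) sequentially"
    using eventually_gt_at_top[of m]
  proof eventually_elim
    case (elim N)
    have "(\<Sum>n<N. fps_nth (xi_term (Suc n)) m) = (\<Sum>n\<le>m. fps_nth (xi_term (Suc n)) m)"
      by (rule sum.mono_neutral_right) (use elim in \<open>auto intro!: xi_term_nth_eq_0\<close>)
    thus ?case by (simp add: fps_sum_nth)
  qed
qed

lemma summable_xi_term: "summable (\<lambda>n. xi_term (Suc n))"
  using xi_term_sums by (rule sums_summable)

end

theory Submission
  imports Defs
begin

text \<open>
  Partial fractions and the Durfee rectangle identity turn \<open>\<xi>\<close> into an Appell--Lerch sum: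
  \<open>(\<xi>(q) - 1) (q\<^sup>6; q\<^sup>6)\<^sub>\<infinity> = 2 q \<Sum>\<^sub>r (-1)\<^sup>r q\<^bsup>9r(r+1)\<^esup> / (1 - q\<^bsup>6r+1\<^esup>)\<close>, summed over all
  integers \<open>r\<close>. Extracting the exponents divisible by 3 leaves
  \<open>(q\<^sup>2; q\<^sup>2)\<^sub>\<infinity> \<Sum>\<^sub>n p\<^sub>\<xi>(3n) q\<^sup>n = U(q)\<close>, where, with \<open>p = q\<^sup>3\<close>,
  \<open>U(w) = \<Sum>\<^sub>r (-1)\<^sup>r p\<^bsup>r\<^sup>2\<^esup> w\<^sup>r (1 + w p\<^bsup>2r\<^esup>) / (1 - w p\<^bsup>2r\<^esup>)\<close> satisfies
  \<open>U(p\<^sup>2 w) = - U(w) / (p w)\<close> and \<open>U(1 / w) = - U(w)\<close>. Multiplying \<open>U\<close> by a theta series that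
  vanishes at its poles gives a two-term recurrence for the Laurent coefficients in \<open>w\<close>, so \<open>U\<close> is
  a quotient of theta series up to a factor that is found at the pole \<open>w = 1\<close>. The outcome is
  \<open>\<Sum>\<^sub>n p\<^sub>\<xi>(3n) q\<^sup>n = \<phi>(-q\<^sup>3)\<^sup>2 / \<phi>(-q)\<close>. Writing \<open>\<phi>(-q) = 1 + 2 A(q)\<close> and
  \<open>\<phi>(-q\<^sup>3) = 1 + 2 B(q)\<close>, this is \<open>1 - 2 A + 4 A\<^sup>2 + 4 B + 4 B\<^sup>2\<close> modulo 8, and squaring is
  \<open>q \<mapsto> q\<^sup>2\<close> modulo 2.
\<close>

section \<open>Locally finite sums of formal power series\<close>

text \<open>\<open>U\<close> depends on two variables, while every series here is in
  \<open>q\<close> alone. So \<open>w\<close> never appears: a Laurent series in \<open>w\<close> is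
  the family of its coefficients indexed by the integers, a product in \<open>w\<close> is a
  convolution, and putting \<open>w = q\<close> or \<open>w = 1\<close> is a sum over the family.
  Hence the need for sums over arbitrary index types. The functional equations of \<open>U\<close>
  and of its theta multiplier combine into a recurrence between coefficients at distance 2. It
  leaves two free values, which the symmetry \<open>w -> 1/w\<close> identifies. At
  \<open>w = 1\<close> a zero of the theta series meets the pole of \<open>U\<close>, so the
  remaining factor is given by a derivative of theta, which Jacobi's identity for the cube of
  \<open>(Q; Q)\<close> evaluates. That identity, the triple product and the Appell-Lerch form all
  rest on one fact: a Durfee sum does not depend on the side difference of its rectangles. The final
  quotient stays multiplied out, and common factors are cancelled in the integral domain of integer
  power series.\<close>

definition fps_summable :: "('i \<Rightarrow> int fps) \<Rightarrow> bool" where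
  "fps_summable f \<longleftrightarrow> (\<forall>n. finite {i. fps_nth (f i) n \<noteq> 0})"

text \<open>If infinitely many indices contribute to a coefficient, the sum over an infinite set
  makes that coefficient 0. Additivity and Fubini therefore carry \<open>fps_summable\<close>
  assumptions.\<close>

definition fps_Sum :: "('i \<Rightarrow> int fps) \<Rightarrow> int fps" where
  "fps_Sum f = Abs_fps (\<lambda>n. \<Sum>i | fps_nth (f i) n \<noteq> 0. fps_nth (f i) n)"

lemma fps_summableI:
  assumes "\<And>n. finite (I n)" "\<And>n i. fps_nth (f i) n \<noteq> 0 \<Longrightarrow> i \<in> I n"
  shows "fps_summable f"
  unfolding fps_summable_def
proof
  show "finite {i. fps_nth (f i) n \<noteq> 0}" for n
    using assms(1)[of n] by (rule rev_finite_subset) (use assms(2) in auto)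
qed

lemma fps_summableD: "fps_summable f \<Longrightarrow> finite {i. fps_nth (f i) n \<noteq> 0}"
  by (simp add: fps_summable_def)

text \<open>Coefficient \<open>n\<close> of a product draws on all lower coefficients, so
  multiplication needs finiteness for all of them at once.\<close>

lemma fps_summableD_le:
  assumes "fps_summable f"
  shows "finite {i. \<exists>m\<le>n. fps_nth (f i) m \<noteq> 0}"
proof -
  have "{i. \<exists>m\<le>n. fps_nth (f i) m \<noteq> 0} = (\<Union>m\<le>n. {i. fps_nth (f i) m \<noteq> 0})" by auto
  thus ?thesis using assms by (simp add: fps_summable_def)
qed

lemma fps_Sum_nth:
  assumes "finite I" "\<And>i. fps_nth (f i) n \<noteq> 0 \<Longrightarrow> i \<in> I"
  shows "fps_nth (fps_Sum f) n = (\<Sum>i\<in>I. fps_nth (f i) n)"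
  unfolding fps_Sum_def fps_nth_Abs_fps
  by (rule sum.mono_neutral_left) (use assms in auto)

lemma fps_Sum_nth_0: "(\<And>i. fps_nth (f i) n = 0) \<Longrightarrow> fps_nth (fps_Sum f) n = 0"
  by (simp add: fps_Sum_def)

lemma fps_Sum_zero [simp]: "fps_Sum (\<lambda>i. 0) = 0"
  by (simp add: fps_eq_iff fps_Sum_nth_0)

lemma fps_summable_add:
  assumes "fps_summable f" "fps_summable g"
  shows "fps_summable (\<lambda>i. f i + g i)"
  by (rule fps_summableI[of "\<lambda>n. {i. fps_nth (f i) n \<noteq> 0} \<union> {i. fps_nth (g i) n \<noteq> 0}"])
    (use assms in \<open>auto simp: fps_summable_def\<close>)

lemma fps_Sum_add:
  assumes "fps_summable f" "fps_summable g"
  shows "fps_Sum (\<lambda>i. f i + g i) = fps_Sum f + fps_Sum g"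
proof (rule fps_ext)
  fix n
  define I where "I = {i. fps_nth (f i) n \<noteq> 0} \<union> {i. fps_nth (g i) n \<noteq> 0}"
  have I: "finite I" using assms by (auto simp: fps_summable_def I_def)
  show "fps_nth (fps_Sum (\<lambda>i. f i + g i)) n = fps_nth (fps_Sum f + fps_Sum g) n"
    by (subst fps_add_nth, subst (1 2 3) fps_Sum_nth[OF I])
      (auto simp: I_def sum.distrib)
qed

lemma fps_summable_mult_left:
  assumes "fps_summable f"
  shows "fps_summable (\<lambda>i. c * f i)"
proof (rule fps_summableI)
  show "finite {i. \<exists>m\<le>n. fps_nth (f i) m \<noteq> 0}" for n
    using assms by (rule fps_summableD_le)
  show "i \<in> {i. \<exists>m\<le>n. fps_nth (f i) m \<noteq> 0}" if "fps_nth (c * f i) n \<noteq> 0" for i n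
  proof (rule ccontr)
    assume "\<not> ?thesis"
    hence "fps_nth (f i) m = 0" if "m \<le> n" for m using that by auto
    hence "fps_nth (c * f i) n = 0" by (simp add: fps_mult_nth)
    thus False using that by simp
  qed
qed

lemma fps_Sum_mult_left:
  assumes "fps_summable f"
  shows "fps_Sum (\<lambda>i. c * f i) = c * fps_Sum f"
proof (rule fps_ext)
  fix n
  define I where "I = {i. \<exists>m\<le>n. fps_nth (f i) m \<noteq> 0}"
  have I: "finite I" unfolding I_def using assms by (rule fps_summableD_le)
  have z: "fps_nth (f i) m = 0" if "i \<notin> I" "m \<le> n" for i m
    using that by (auto simp: I_def)
  have "fps_nth (fps_Sum (\<lambda>i. c * f i)) n = (\<Sum>i\<in>I. fps_nth (c * f i) n)"
  proof (rule fps_Sum_nth[OF I])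
    show "i \<in> I" if "fps_nth (c * f i) n \<noteq> 0" for i
      using that z[of i] by (force simp: fps_mult_nth)
  qed
  also have "\<dots> = (\<Sum>j=0..n. fps_nth c j * (\<Sum>i\<in>I. fps_nth (f i) (n - j)))"
    unfolding fps_mult_nth by (subst sum.swap) (simp add: sum_distrib_left)
  also have "\<dots> = (\<Sum>j=0..n. fps_nth c j * fps_nth (fps_Sum f) (n - j))"
  proof (rule sum.cong[OF refl])
    fix j
    have "fps_nth (fps_Sum f) (n - j) = (\<Sum>i\<in>I. fps_nth (f i) (n - j))"
      by (rule fps_Sum_nth[OF I]) (use z in force)
    thus "fps_nth c j * (\<Sum>i\<in>I. fps_nth (f i) (n - j)) = fps_nth c j * fps_nth (fps_Sum f) (n - j)"
      by simp
  qed
  finally show "fps_nth (fps_Sum (\<lambda>i. c * f i)) n = fps_nth (c * fps_Sum f) n"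
    by (simp add: fps_mult_nth)
qed

lemma fps_summable_mult_right: "fps_summable f \<Longrightarrow> fps_summable (\<lambda>i. f i * c)"
  using fps_summable_mult_left[of f c] by (simp add: mult.commute)

lemma fps_Sum_mult_right: "fps_summable f \<Longrightarrow> fps_Sum (\<lambda>i. f i * c) = fps_Sum f * c"
  using fps_Sum_mult_left[of f c] by (simp add: mult.commute)

lemma fps_summable_minus: "fps_summable f \<Longrightarrow> fps_summable (\<lambda>i. - f i)"
  by (simp add: fps_summable_def)

lemma fps_Sum_minus: "fps_Sum (\<lambda>i. - f i) = - fps_Sum f"
  by (simp add: fps_eq_iff fps_Sum_def sum_negf)

lemma fps_summable_diff:
  "fps_summable f \<Longrightarrow> fps_summable g \<Longrightarrow> fps_summable (\<lambda>i. f i - g i)"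
  using fps_summable_add[of f "\<lambda>i. - g i"] fps_summable_minus by auto

lemma fps_Sum_diff:
  "fps_summable f \<Longrightarrow> fps_summable g \<Longrightarrow> fps_Sum (\<lambda>i. f i - g i) = fps_Sum f - fps_Sum g"
  using fps_Sum_add[of f "\<lambda>i. - g i"] fps_summable_minus[of g] fps_Sum_minus[of g] by simp

lemma fps_summable_reindex:
  assumes "inj h" "fps_summable f"
  shows "fps_summable (\<lambda>i. f (h i))"
  unfolding fps_summable_def
proof
  fix n
  have "{i. fps_nth (f (h i)) n \<noteq> 0} = h -` {i. fps_nth (f i) n \<noteq> 0}" by auto
  thus "finite {i. fps_nth (f (h i)) n \<noteq> 0}"
    using assms finite_vimageI[of "{i. fps_nth (f i) n \<noteq> 0}" h] by (simp add: fps_summable_def)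
qed

lemma fps_Sum_reindex:
  assumes "inj h" "\<And>i. i \<notin> range h \<Longrightarrow> f i = 0"
  shows "fps_Sum (\<lambda>i. f (h i)) = fps_Sum f"
proof (rule fps_ext)
  fix n
  have "bij_betw h {i. fps_nth (f (h i)) n \<noteq> 0} {i. fps_nth (f i) n \<noteq> 0}"
    unfolding bij_betw_def
  proof
    show "inj_on h {i. fps_nth (f (h i)) n \<noteq> 0}" using assms(1) by (rule inj_on_subset) auto
    show "h ` {i. fps_nth (f (h i)) n \<noteq> 0} = {i. fps_nth (f i) n \<noteq> 0}"
    proof safe
      fix i assume "fps_nth (f i) n \<noteq> 0"
      then obtain j where "i = h j" using assms(2)[of i] by fastforce
      thus "i \<in> h ` {i. fps_nth (f (h i)) n \<noteq> 0}" using \<open>fps_nth (f i) n \<noteq> 0\<close> by blast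
    qed
  qed
  from sum.reindex_bij_betw[OF this, of "\<lambda>i. fps_nth (f i) n"]
  show "fps_nth (fps_Sum (\<lambda>i. f (h i))) n = fps_nth (fps_Sum f) n"
    by (simp add: fps_Sum_def)
qed

lemma fps_Sum_reindex_bij: "bij h \<Longrightarrow> fps_Sum (\<lambda>i. f (h i)) = fps_Sum f"
  by (rule fps_Sum_reindex) (auto simp: bij_def)

text \<open>Fubini. Summability is demanded over pairs, because one iterated sum can exist without
  the other, as happens later at \<open>w = 1\<close>.\<close>

lemma fps_summable_Pair:
  assumes "fps_summable (\<lambda>(i, j). h i j)"
  shows "fps_summable (h i)" "fps_summable (\<lambda>i. fps_Sum (h i))"
    "fps_Sum (\<lambda>i. fps_Sum (h i)) = fps_Sum (\<lambda>(i, j). h i j)"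
proof -
  define P where "P n = {(i, j). fps_nth (h i j) n \<noteq> 0}" for n
  have P: "finite (P n)" for n
    using fps_summableD[OF assms, of n] by (simp add: P_def case_prod_unfold)
  show *: "fps_summable (h i)" for i
    by (rule fps_summableI[of "\<lambda>n. snd ` P n"]) (use P in \<open>force simp: P_def\<close>)+
  have nz: "i \<in> fst ` P n" if "fps_nth (fps_Sum (h i)) n \<noteq> 0" for i n
    using that fps_Sum_nth_0[of "h i" n] by (force simp: P_def)
  show "fps_summable (\<lambda>i. fps_Sum (h i))"
    by (rule fps_summableI[of "\<lambda>n. fst ` P n"]) (use P nz in auto)
  show "fps_Sum (\<lambda>i. fps_Sum (h i)) = fps_Sum (\<lambda>(i, j). h i j)"
  proof (rule fps_ext)
    fix n
    have "fps_nth (fps_Sum (\<lambda>i. fps_Sum (h i))) n = (\<Sum>i\<in>fst ` P n. fps_nth (fps_Sum (h i)) n)"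
      by (rule fps_Sum_nth) (use P nz in auto)
    also have "\<dots> = (\<Sum>i\<in>fst ` P n. \<Sum>j\<in>snd ` P n. fps_nth (h i j) n)"
      by (rule sum.cong[OF refl], rule fps_Sum_nth) (use P in \<open>force simp: P_def\<close>)+
    also have "\<dots> = (\<Sum>x\<in>fst ` P n \<times> snd ` P n. fps_nth (case x of (i, j) \<Rightarrow> h i j) n)"
      by (simp add: sum.cartesian_product case_prod_unfold)
    also have "\<dots> = fps_nth (fps_Sum (\<lambda>(i, j). h i j)) n"
      by (rule fps_Sum_nth[symmetric]) (use P in \<open>force simp: P_def\<close>)+
    finally show "fps_nth (fps_Sum (\<lambda>i. fps_Sum (h i))) n = fps_nth (fps_Sum (\<lambda>(i, j). h i j)) n" .
  qed
qed

lemma fps_summable_swap: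
  "fps_summable (\<lambda>(i, j). h i j) \<Longrightarrow> fps_summable (\<lambda>(j, i). h i j)"
  using fps_summable_reindex[of prod.swap "\<lambda>(i, j). h i j"]
  by (simp add: case_prod_unfold)

lemma fps_Sum_swap:
  assumes "fps_summable (\<lambda>(i, j). h i j)"
  shows "fps_Sum (\<lambda>i. fps_Sum (\<lambda>j. h i j)) = fps_Sum (\<lambda>j. fps_Sum (\<lambda>i. h i j))"
proof -
  have "fps_Sum (\<lambda>(i, j). h i j) = fps_Sum (\<lambda>(j, i). h i j)"
    using fps_Sum_reindex_bij[of prod.swap "\<lambda>(i, j). h i j"] by (simp add: case_prod_unfold)
  thus ?thesis
    using fps_summable_Pair(3)[OF assms] fps_summable_Pair(3)[OF fps_summable_swap[OF assms]]
    by simp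
qed

text \<open>For a fixed coefficient, \<open>f\<close> admits only finitely many \<open>i\<close>,
  and each of these admits finitely many \<open>j\<close>.\<close>

lemma fps_summable_mult_Pair:
  assumes "fps_summable f" "\<And>i. fps_summable (g i)"
  shows "fps_summable (\<lambda>(i, j). f i * g i j)"
proof (rule fps_summableI)
  define I where "I n = {i. \<exists>m\<le>n. fps_nth (f i) m \<noteq> 0}" for n
  define J where "J i n = {j. \<exists>m\<le>n. fps_nth (g i j) m \<noteq> 0}" for i n
  show "finite (SIGMA i:I n. J i n)" for n
    using assms by (auto simp: I_def J_def intro!: finite_SigmaI fps_summableD_le)
  show "x \<in> (SIGMA i:I n. J i n)" if "fps_nth (case x of (i, j) \<Rightarrow> f i * g i j) n \<noteq> 0" for x n
  proof -
    obtain i j where x: "x = (i, j)" by force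
    have "(\<Sum>k=0..n. fps_nth (f i) k * fps_nth (g i j) (n - k)) \<noteq> 0"
      using that by (simp add: x fps_mult_nth)
    then obtain k where "k \<in> {0..n}" "fps_nth (f i) k * fps_nth (g i j) (n - k) \<noteq> 0"
      by (rule sum.not_neutral_contains_not_neutral)
    hence "k \<le> n" "fps_nth (f i) k \<noteq> 0" "fps_nth (g i j) (n - k) \<noteq> 0" by auto
    thus ?thesis unfolding x I_def J_def using diff_le_self[of n k] by blast
  qed
qed

lemma fps_Sum_product:
  assumes "fps_summable f" "fps_summable g"
  shows "fps_Sum f * fps_Sum g = fps_Sum (\<lambda>(i, j). f i * g j)"
proof -
  have "fps_Sum (\<lambda>(i, j). f i * g j) = fps_Sum (\<lambda>i. fps_Sum (\<lambda>j. f i * g j))"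
    by (rule fps_summable_Pair(3)[symmetric]) (rule fps_summable_mult_Pair[OF assms])
  also have "\<dots> = fps_Sum (\<lambda>i. f i * fps_Sum g)"
    by (simp add: fps_Sum_mult_left assms)
  also have "\<dots> = fps_Sum f * fps_Sum g"
    by (rule fps_Sum_mult_right) fact
  finally show ?thesis by simp
qed

lemma fps_summable_finite: "finite {i. f i \<noteq> 0} \<Longrightarrow> fps_summable f"
  unfolding fps_summable_def by (auto elim!: rev_finite_subset)

lemma fps_Sum_finite:
  assumes "finite I" "\<And>i. i \<notin> I \<Longrightarrow> f i = 0"
  shows "fps_Sum f = sum f I"
proof (rule fps_ext)
  fix n
  have "fps_nth (fps_Sum f) n = (\<Sum>i\<in>I. fps_nth (f i) n)"
    by (rule fps_Sum_nth) (use assms in force)+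
  thus "fps_nth (fps_Sum f) n = fps_nth (sum f I) n" by (simp add: fps_sum_nth)
qed

lemma fps_Sum_Suc:
  assumes "fps_summable f"
  shows "fps_Sum f = f 0 + fps_Sum (\<lambda>n. f (Suc n))"
proof -
  define g where "g n = (if n = 0 then f 0 else 0)" for n :: nat
  define h where "h n = (if n = 0 then 0 else f n)" for n :: nat
  have g: "fps_Sum g = f 0" using fps_Sum_finite[of "{0}" g] by (simp add: g_def)
  have h: "fps_Sum h = fps_Sum (\<lambda>n. h (Suc n))"
    by (rule fps_Sum_reindex[symmetric]) (auto simp: h_def image_iff gr0_conv_Suc)
  have "fps_Sum f = fps_Sum (\<lambda>n. g n + h n)"
    by (rule arg_cong[of _ _ fps_Sum]) (auto simp: g_def h_def)
  also have "\<dots> = fps_Sum g + fps_Sum h"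
  proof (rule fps_Sum_add)
    show "fps_summable g" by (rule fps_summable_finite) (auto simp: g_def)
    show "fps_summable h"
      by (rule fps_summableI[of "\<lambda>n. {i. fps_nth (f i) n \<noteq> 0}"])
        (use assms in \<open>auto simp: fps_summable_def h_def split: if_splits\<close>)
  qed
  finally show ?thesis unfolding g h by (simp add: h_def)
qed

lemma fps_Sum_int:
  fixes f :: "int \<Rightarrow> int fps"
  assumes "fps_summable f"
  shows "fps_Sum f = fps_Sum (\<lambda>n. f (int n)) + fps_Sum (\<lambda>n. f (- 1 - int n))"
proof -
  define g where "g i = (if i \<ge> 0 then f i else 0)" for i
  define h where "h i = (if i \<ge> 0 then 0 else f i)" for i
  have g: "fps_Sum g = fps_Sum (\<lambda>n. g (int n))"
    by (rule fps_Sum_reindex[symmetric]) (auto simp: g_def inj_on_def image_iff intro: nonneg_int_cases)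
  have h: "fps_Sum h = fps_Sum (\<lambda>n. h (- 1 - int n))"
  proof (rule fps_Sum_reindex[symmetric])
    show "h i = 0" if "i \<notin> range (\<lambda>n. - 1 - int n)" for i
    proof (rule ccontr)
      assume "h i \<noteq> 0"
      hence "i < 0" by (auto simp: h_def split: if_splits)
      hence "i = - 1 - int (nat (- 1 - i))" by simp
      thus False using that by blast
    qed
  qed (auto simp: inj_on_def)
  have "fps_Sum f = fps_Sum (\<lambda>i. g i + h i)"
    by (rule arg_cong[of _ _ fps_Sum]) (auto simp: g_def h_def)
  also have "\<dots> = fps_Sum g + fps_Sum h"
    by (rule fps_Sum_add; rule fps_summableI[of "\<lambda>n. {i. fps_nth (f i) n \<noteq> 0}"])
      (use assms in \<open>auto simp: fps_summable_def g_def h_def split: if_splits\<close>)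
  finally show ?thesis unfolding g h by (simp add: g_def h_def)
qed

lemma nth_X_power_mult_nonzero:
  "fps_nth (fps_X ^ e * g) n \<noteq> 0 \<Longrightarrow> e \<le> n" for g :: "int fps"
  by (auto simp: fps_X_power_mult_nth split: if_splits)

lemma fps_summable_nat:
  assumes "\<And>m. f m = fps_X ^ e m * g m" "\<And>m. m \<le> e m + c"
  shows "fps_summable f"
proof (rule fps_summableI)
  show "m \<in> {..n + c}" if "fps_nth (f m) n \<noteq> 0" for m n
    using nth_X_power_mult_nonzero[of "e m" "g m" n] that assms by (metis atMost_iff le_trans add_le_mono1)
qed auto

lemma fps_summable_int:
  assumes "\<And>i::int. f i = fps_X ^ e i * g i" "\<And>i. \<bar>i\<bar> \<le> int (e i) + c"
  shows "fps_summable f"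
proof (rule fps_summableI)
  show "i \<in> {- (int n + c)..int n + c}" if "fps_nth (f i) n \<noteq> 0" for i n
    using nth_X_power_mult_nonzero[of "e i" "g i" n] that assms(1)[of i] assms(2)[of i] by auto
qed auto

lemma fps_Sum_mod_X_power:
  assumes "f 0 = f0" "\<And>m. f (Suc m) = fps_X ^ k * g m" "fps_summable f" "n < k"
  shows "fps_nth (fps_Sum f) n = fps_nth f0 n"
proof -
  have "fps_nth (fps_Sum (\<lambda>m. f (Suc m))) n = 0"
    using assms(4) by (intro fps_Sum_nth_0) (simp add: assms(2) fps_X_power_mult_nth)
  thus ?thesis using fps_Sum_Suc[OF assms(3)] assms(1) by simp
qed

section \<open>Congruence modulo powers of q, and uniqueness under recurrences\<close>

lemma X_power_dvd_iff: "fps_X ^ n dvd (f :: int fps) \<longleftrightarrow> (\<forall>i<n. fps_nth f i = 0)"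
proof
  assume "fps_X ^ n dvd f"
  then obtain g where "f = fps_X ^ n * g" by (elim dvdE)
  thus "\<forall>i<n. fps_nth f i = 0" by (simp add: fps_X_power_mult_nth)
next
  assume "\<forall>i<n. fps_nth f i = 0"
  hence "f = fps_X ^ n * fps_shift n f"
    by (intro fps_ext) (simp add: fps_X_power_mult_nth)
  thus "fps_X ^ n dvd f" by (metis dvd_triv_left)
qed

lemma fps_eq_if_dvd:
  assumes "\<And>n. fps_X ^ n dvd (f - g :: int fps)"
  shows "f = g"
proof (rule fps_ext)
  fix n show "fps_nth f n = fps_nth g n"
    using assms[of "Suc n"] unfolding X_power_dvd_iff by simp
qed

text \<open>Unrolling \<open>n\<close> steps writes \<open>g 0 - h 0\<close> as a multiple of
  \<open>g n - h n\<close>, hence of every power of \<open>q\<close>. Infinite products and Euler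
  series are embedded in such a family by raising their starting exponent, so that they tend to
  1.\<close>

lemma fps_eq_if_same_recurrence:
  fixes g h :: "nat \<Rightarrow> int fps"
  assumes "\<And>j. g j = c j * g (Suc j)" "\<And>j. h j = c j * h (Suc j)"
    and "\<And>j. fps_X ^ j dvd g j - h j"
  shows "g 0 = h 0"
proof (rule fps_eq_if_dvd)
  fix n
  have "g 0 - h 0 = (\<Prod>j<n. c j) * (g n - h n)"
  proof (induction n)
    case (Suc n)
    have "g n - h n = c n * (g (Suc n) - h (Suc n))"
      using assms(1,2)[of n] by (metis right_diff_distrib)
    thus ?case unfolding Suc by (simp add: mult_ac)
  qed simp
  thus "fps_X ^ n dvd g 0 - h 0" using assms(3)[of n] by simp
qed

section \<open>Infinite products and theta series\<close>

definition geom :: "nat \<Rightarrow> int fps" where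
  "geom k = Abs_fps (\<lambda>n. if k dvd n then 1 else 0)"

lemma geom_mult:
  assumes "k > 0"
  shows "(1 - fps_X ^ k) * geom k = 1"
proof (rule fps_ext)
  fix n
  have "k dvd n - k \<longleftrightarrow> k dvd n" if "n \<ge> k" using that by (simp add: dvd_minus_self)
  thus "fps_nth ((1 - fps_X ^ k) * geom k) n = fps_nth 1 n"
    using assms by (auto simp: ring_distribs geom_def fps_X_power_mult_nth dest: dvd_imp_le)
qed

text \<open>\<open>inv_qfac b m\<close> is \<open>1 / (Q; Q)\<^sub>m\<close> for \<open>Q = q\<^sup>b\<close>.\<close>

definition inv_qfac :: "nat \<Rightarrow> nat \<Rightarrow> int fps" where
  "inv_qfac b m = (\<Prod>i<m. geom (b * Suc i))"

lemma inv_qfac_0 [simp]: "inv_qfac b 0 = 1"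
  by (simp add: inv_qfac_def)

lemma inv_qfac_Suc:
  assumes "b > 0"
  shows "(1 - fps_X ^ (b * Suc m)) * inv_qfac b (Suc m) = inv_qfac b m"
proof -
  have "(1 - fps_X ^ (b * Suc m)) * inv_qfac b (Suc m) =
      ((1 - fps_X ^ (b * Suc m)) * geom (b * Suc m)) * inv_qfac b m"
    by (simp add: inv_qfac_def mult_ac)
  also have "\<dots> = inv_qfac b m"
    by (subst geom_mult) (use assms in simp_all)
  finally show ?thesis .
qed

text \<open>
  The sums over Durfee rectangles; comparing \<open>durfee b k\<close> and \<open>durfee b (k + 1)\<close> through
  \<open>durfee'\<close> shows that \<open>durfee b k\<close> does not depend on \<open>k\<close>, so it is its limit \<open>1 / (Q; Q)\<^sub>\<infinity>\<close>.
\<close>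

definition durfee :: "nat \<Rightarrow> nat \<Rightarrow> int fps" where
  "durfee b k = fps_Sum (\<lambda>m. fps_X ^ (b * (m * (m + k))) * (inv_qfac b m * inv_qfac b (m + k)))"

definition durfee' :: "nat \<Rightarrow> nat \<Rightarrow> int fps" where
  "durfee' b k = fps_Sum (\<lambda>m. fps_X ^ (b * (m * (m + k) + m)) * (inv_qfac b m * inv_qfac b (m + k)))"

lemma summable_durfee:
  assumes "b > 0"
  shows "fps_summable (\<lambda>m. fps_X ^ (b * (m * (m + k))) * (inv_qfac b m * inv_qfac b (m + k)))"
proof (rule fps_summable_nat)
  show "m \<le> b * (m * (m + k)) + 0" for m
  proof (cases "m = 0")
    case False
    hence "1 \<le> b * (m + k)" using assms by (simp add: Suc_le_eq)
    thus ?thesis using mult_le_mono2[of 1 "b * (m + k)" m] by (simp add: mult_ac)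
  qed simp
qed (rule refl)

lemma summable_durfee':
  assumes "b > 0"
  shows "fps_summable (\<lambda>m. fps_X ^ (b * (m * (m + k) + m)) * (inv_qfac b m * inv_qfac b (m + k)))"
proof (rule fps_summable_nat)
  show "m \<le> b * (m * (m + k) + m) + 0" for m
    using assms by (simp add: trans_le_add2 add_mult_distrib2)
qed (rule refl)

text \<open>The difference of the \<open>m\<close>-th terms carries \<open>1 - Q^m\<close>, with
  \<open>Q = q^b\<close>. This kills the term \<open>m = 0\<close> and removes the last factor of
  \<open>inv_qfac b m\<close>; shifting \<open>m\<close> by one then produces \<open>durfee'\<close>
  at \<open>Suc k\<close>.\<close>

lemma durfee_eq1:
  assumes b: "b > 0"
  shows "durfee b k = durfee' b k + fps_X ^ (b * Suc k) * durfee' b (Suc k)"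
proof -
  define f where "f m = fps_X ^ (b * (m * (m + k))) * (inv_qfac b m * inv_qfac b (m + k))
    - fps_X ^ (b * (m * (m + k) + m)) * (inv_qfac b m * inv_qfac b (m + k))" for m
  have f: "fps_summable f" unfolding f_def
    by (intro fps_summable_diff summable_durfee summable_durfee' b)
  have "durfee b k - durfee' b k = fps_Sum f"
    unfolding durfee_def durfee'_def f_def
    by (rule fps_Sum_diff[symmetric]; intro summable_durfee summable_durfee' b)
  also have "\<dots> = f 0 + fps_Sum (\<lambda>m. f (Suc m))" by (rule fps_Sum_Suc[OF f])
  also have "f 0 = 0" by (simp add: f_def)
  also have "(\<lambda>m. f (Suc m)) = (\<lambda>m. fps_X ^ (b * Suc k) *
      (fps_X ^ (b * (m * (m + Suc k) + m)) * (inv_qfac b m * inv_qfac b (m + Suc k))))"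
  proof
    fix m
    have e: "b * (Suc m * (Suc m + k)) = b * Suc k + b * (m * (m + Suc k) + m)"
      "b * (Suc m * (Suc m + k) + Suc m) = b * Suc k + b * (m * (m + Suc k) + m) + b * Suc m"
      by (simp_all add: algebra_simps)
    have "f (Suc m) = fps_X ^ (b * Suc k) * (fps_X ^ (b * (m * (m + Suc k) + m)) *
        (((1 - fps_X ^ (b * Suc m)) * inv_qfac b (Suc m)) * inv_qfac b (m + Suc k)))"
      unfolding f_def e by (simp add: power_add algebra_simps del: mult_Suc mult_Suc_right)
    thus "f (Suc m) = fps_X ^ (b * Suc k) *
      (fps_X ^ (b * (m * (m + Suc k) + m)) * (inv_qfac b m * inv_qfac b (m + Suc k)))"
      using inv_qfac_Suc[OF b, of m] by simp
  qed
  also have "fps_Sum \<dots> = fps_X ^ (b * Suc k) * durfee' b (Suc k)"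
    unfolding durfee'_def by (rule fps_Sum_mult_left[OF summable_durfee'[OF b]])
  finally show ?thesis by (simp add: algebra_simps)
qed

text \<open>Here the two \<open>m\<close>-th terms have the same power of \<open>Q\<close> in front
  and differ by \<open>1 - Q^(m+k+1)\<close> in one reciprocal, so the same right-hand side as in
  \<open>durfee_eq1\<close> appears without an index shift.\<close>

lemma durfee_eq2:
  assumes b: "b > 0"
  shows "durfee b (Suc k) = durfee' b k + fps_X ^ (b * Suc k) * durfee' b (Suc k)"
proof -
  have "durfee b (Suc k) - durfee' b k =
    fps_Sum (\<lambda>m. fps_X ^ (b * (m * (m + Suc k))) * (inv_qfac b m * inv_qfac b (m + Suc k))
    - fps_X ^ (b * (m * (m + k) + m)) * (inv_qfac b m * inv_qfac b (m + k)))"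
    unfolding durfee_def durfee'_def
    by (rule fps_Sum_diff[symmetric]; intro summable_durfee summable_durfee' b)
  also have "(\<lambda>m. fps_X ^ (b * (m * (m + Suc k))) * (inv_qfac b m * inv_qfac b (m + Suc k))
    - fps_X ^ (b * (m * (m + k) + m)) * (inv_qfac b m * inv_qfac b (m + k))) =
    (\<lambda>m. fps_X ^ (b * Suc k) *
      (fps_X ^ (b * (m * (m + Suc k) + m)) * (inv_qfac b m * inv_qfac b (m + Suc k))))"
  proof
    fix m
    have e: "b * (m * (m + Suc k)) = b * (m * (m + k) + m)"
      "fps_X ^ (b * (m * (m + Suc k) + m)) =
       fps_X ^ (b * (m * (m + k) + m)) * (fps_X ^ (b * m) :: int fps)"
      "fps_X ^ (b * Suc (m + k)) = fps_X ^ (b * Suc k) * (fps_X ^ (b * m) :: int fps)"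
      by (simp_all add: algebra_simps flip: power_add)
    have y: "inv_qfac b (m + k) = (1 - fps_X ^ (b * Suc (m + k))) * inv_qfac b (m + Suc k)"
      using inv_qfac_Suc[OF b, of "m + k"] by simp
    show "fps_X ^ (b * (m * (m + Suc k))) * (inv_qfac b m * inv_qfac b (m + Suc k))
    - fps_X ^ (b * (m * (m + k) + m)) * (inv_qfac b m * inv_qfac b (m + k)) =
     fps_X ^ (b * Suc k) *
      (fps_X ^ (b * (m * (m + Suc k) + m)) * (inv_qfac b m * inv_qfac b (m + Suc k)))"
      unfolding e(1) y unfolding e(2,3) by (simp add: algebra_simps)
  qed
  also have "fps_Sum \<dots> = fps_X ^ (b * Suc k) * durfee' b (Suc k)"
    unfolding durfee'_def by (rule fps_Sum_mult_left[OF summable_durfee'[OF b]])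
  finally show ?thesis by (simp add: algebra_simps)
qed

lemma durfee_const: "b > 0 \<Longrightarrow> durfee b k = durfee b 0"
  by (induction k) (simp_all only: durfee_eq2 flip: durfee_eq1)

text \<open>Only the term \<open>m = 0\<close> survives modulo \<open>q^k\<close>. Together with
  \<open>durfee_const\<close> this reads off the common value to any precision.\<close>

lemma durfee_mod:
  assumes b: "b > 0"
  shows "fps_X ^ k dvd durfee b k - inv_qfac b k"
  unfolding X_power_dvd_iff
proof (intro allI impI)
  fix n assume "n < k"
  have "fps_nth (durfee b k) n = fps_nth (inv_qfac b k) n"
    unfolding durfee_def
  proof (rule fps_Sum_mod_X_power[OF _ _ summable_durfee[OF b]])
    have e: "b * (Suc m * (Suc m + k)) = k + (b * (Suc m * (Suc m + k)) - k)" for m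
      using b by (cases b) (auto simp: algebra_simps)
    show "fps_X ^ (b * (Suc m * (Suc m + k))) * (inv_qfac b (Suc m) * inv_qfac b (Suc m + k))
      = fps_X ^ k * (fps_X ^ (b * (Suc m * (Suc m + k)) - k) * (inv_qfac b (Suc m) * inv_qfac b (Suc m + k)))" for m
      by (subst e) (simp only: power_add mult.assoc)
  qed (use \<open>n < k\<close> in auto)
  thus "fps_nth (durfee b k - inv_qfac b k) n = 0" by simp
qed

text \<open>
  The product of \<open>1 + s q\<^bsup>a + b i\<^esup>\<close> over all \<open>i \<ge> 0\<close>: for \<open>b > 0\<close> the factors with \<open>i > n\<close> do
  not affect the coefficient of \<open>q\<^sup>n\<close>.
\<close>

definition qprod :: "int fps \<Rightarrow> nat \<Rightarrow> nat \<Rightarrow> int fps" where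
  "qprod s a b = Abs_fps (\<lambda>n. fps_nth (\<Prod>i<Suc n. 1 + s * fps_X ^ (a + b * i)) n)"

lemma qprod_mod:
  assumes b: "b > 0"
  shows "fps_X ^ n dvd qprod s a b - (\<Prod>i<n. 1 + s * fps_X ^ (a + b * i))"
proof -
  have *: "fps_nth (\<Prod>i<m + k. 1 + s * fps_X ^ (a + b * i)) n = fps_nth (\<Prod>i<m. 1 + s * fps_X ^ (a + b * i)) n"
    if "n < m" for n m k
  proof (induction k)
    case (Suc k)
    have "m + k \<le> b * (m + k)" using b by simp
    with that have "n < a + b * (m + k)" by (meson less_le_trans trans_less_add1 trans_less_add2)
    hence "fps_nth (p * (1 + s * fps_X ^ (a + b * (m + k)))) n = fps_nth p n" for p
      using X_power_dvd_iff[of "a + b * (m + k)" "p * s * fps_X ^ (a + b * (m + k))"]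
      by (simp add: ring_distribs mult.assoc)
    thus ?case using Suc by simp
  qed simp
  show ?thesis unfolding X_power_dvd_iff
  proof (intro allI impI)
    fix i assume "i < n"
    thus "fps_nth (qprod s a b - (\<Prod>i<n. 1 + s * fps_X ^ (a + b * i))) i = 0"
      using *[of i "Suc i" "n - Suc i"] by (simp add: qprod_def)
  qed
qed

lemma qprod_rec:
  assumes b: "b > 0"
  shows "qprod s a b = (1 + s * fps_X ^ a) * qprod s (a + b) b"
proof (rule fps_eq_if_dvd)
  fix n
  have "(\<Prod>i<Suc n. 1 + s * fps_X ^ (a + b * i)) =
     (1 + s * fps_X ^ a) * (\<Prod>i<n. 1 + s * fps_X ^ (a + b + b * i))"
    by (subst prod.lessThan_Suc_shift) (simp add: algebra_simps)
  hence "qprod s a b - (1 + s * fps_X ^ a) * qprod s (a + b) b =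
     (qprod s a b - (\<Prod>i<Suc n. 1 + s * fps_X ^ (a + b * i)))
     - (1 + s * fps_X ^ a) * (qprod s (a + b) b - (\<Prod>i<n. 1 + s * fps_X ^ (a + b + b * i)))"
    by (simp add: algebra_simps)
  also have "fps_X ^ n dvd \<dots>"
    using dvd_trans[OF le_imp_power_dvd qprod_mod[OF b, of "Suc n" s a], of n]
      qprod_mod[OF b, of n s "a + b"]
    by (intro dvd_diff[OF _ dvd_mult]) simp_all
  finally show "fps_X ^ n dvd qprod s a b - (1 + s * fps_X ^ a) * qprod s (a + b) b" .
qed

lemma qprod_dvd:
  assumes b: "b > 0" and "n \<le> a"
  shows "fps_X ^ n dvd qprod s a b - 1"
proof -
  have "fps_X ^ n dvd (\<Prod>i<k. 1 + s * fps_X ^ (a + b * i)) - 1" for k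
  proof (induction k)
    case (Suc k)
    define P where "P = (\<Prod>i<k. 1 + s * fps_X ^ (a + b * i))"
    have "(\<Prod>i<Suc k. 1 + s * fps_X ^ (a + b * i)) - 1 = (P - 1) + P * s * fps_X ^ (a + b * k)"
      by (simp add: P_def algebra_simps)
    also have "fps_X ^ n dvd \<dots>"
      using Suc \<open>n \<le> a\<close> unfolding P_def[symmetric] by (intro dvd_add dvd_mult le_imp_power_dvd) auto
    finally show ?case .
  qed simp
  from dvd_add[OF this[of n] qprod_mod[OF b, of n s a]] show ?thesis by simp
qed

lemma durfee_qprod:
  assumes b: "b > 0"
  shows "durfee b k * qprod (-1) b b = 1"
proof -
  have "durfee b 0 * qprod (-1) b b = 1"
  proof (rule fps_eq_if_dvd)
    fix n
    define P where "P = (\<Prod>i<n. 1 + (-1) * fps_X ^ (b + b * i) :: int fps)"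
    have "inv_qfac b n * P = 1"
      unfolding P_def
    proof (induction n)
      case (Suc n)
      have "inv_qfac b (Suc n) * (\<Prod>i<Suc n. 1 + (-1) * fps_X ^ (b + b * i)) =
        ((1 - fps_X ^ (b * Suc n)) * inv_qfac b (Suc n)) * (\<Prod>i<n. 1 + (-1) * fps_X ^ (b + b * i))"
        by (simp add: mult_ac)
      also have "\<dots> = 1" unfolding inv_qfac_Suc[OF b] by (rule Suc)
      finally show ?case .
    qed simp
    hence "durfee b 0 * qprod (-1) b b - 1 =
      durfee b 0 * (qprod (-1) b b - P) + (durfee b n - inv_qfac b n) * P"
      using durfee_const[OF b, of n] by (simp add: algebra_simps)
    also have "fps_X ^ n dvd \<dots>"
      unfolding P_def by (intro dvd_add dvd_mult dvd_mult2 durfee_mod[OF b] qprod_mod[OF b])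
    finally show "fps_X ^ n dvd durfee b 0 * qprod (-1) b b - 1" .
  qed
  thus ?thesis using durfee_const[OF b, of k] by simp
qed

text \<open>Factorwise this is \<open>(1 + s x) (1 - s x) = 1 - s^2 x^2\<close>. It is transferred
  to infinite products by removing the first \<open>j\<close> factors on both sides; the two
  splitting lemmas below work in the same way, sorting factors by their index modulo 2 or 3.\<close>

lemma qprod_mult_neg:
  assumes b: "b > 0"
  shows "qprod s a b * qprod (- s) a b = qprod (- (s * s)) (2 * a) (2 * b)"
proof -
  have "qprod s (a + b * 0) b * qprod (- s) (a + b * 0) b = qprod (- (s * s)) (2 * a + 2 * b * 0) (2 * b)"
  proof (rule fps_eq_if_same_recurrence)
    fix j
    show "qprod s (a + b * j) b * qprod (- s) (a + b * j) b =
      (1 - s * s * fps_X ^ (2 * (a + b * j))) * (qprod s (a + b * Suc j) b * qprod (- s) (a + b * Suc j) b)"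
    proof -
      have e: "fps_X ^ (2 * (a + b * j)) = fps_X ^ (a + b * j) * (fps_X ^ (a + b * j) :: int fps)"
        "a + b * Suc j = a + b * j + b"
        by (simp_all add: mult_2 power_add)
      show ?thesis
        unfolding e by (subst (1 2) qprod_rec[OF b]) (simp add: ring_distribs mult_ac)
    qed
    show "qprod (- (s * s)) (2 * a + 2 * b * j) (2 * b) =
      (1 - s * s * fps_X ^ (2 * (a + b * j))) * qprod (- (s * s)) (2 * a + 2 * b * Suc j) (2 * b)"
      by (subst qprod_rec) (use b in \<open>simp_all add: algebra_simps\<close>)
    define A where "A = qprod s (a + b * j) b"
    define B where "B = qprod (- s) (a + b * j) b"
    define C where "C = qprod (- (s * s)) (2 * a + 2 * b * j) (2 * b)"
    have "A * B - C = (A - 1) * B + (B - 1) + (C - 1) * (- 1)" by (simp add: algebra_simps)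
    also have "fps_X ^ j dvd \<dots>"
      unfolding A_def B_def C_def
      by (intro dvd_add dvd_mult2 qprod_dvd) (use b in \<open>simp_all add: trans_le_add2\<close>)
    finally show "fps_X ^ j dvd A * B - C" .
  qed
  thus ?thesis by simp
qed

lemma qprod_split2:
  assumes b: "b > 0"
  shows "qprod s a b = qprod s a (2 * b) * qprod s (a + b) (2 * b)"
proof -
  have "qprod s (a + 2 * b * 0) b = qprod s (a + 2 * b * 0) (2 * b) * qprod s (a + b + 2 * b * 0) (2 * b)"
  proof (rule fps_eq_if_same_recurrence)
    fix j
    show "qprod s (a + 2 * b * j) b = ((1 + s * fps_X ^ (a + 2 * b * j)) * (1 + s * fps_X ^ (a + b + 2 * b * j)))
      * qprod s (a + 2 * b * Suc j) b"
      by (subst qprod_rec[OF b], subst qprod_rec[OF b]) (simp add: algebra_simps)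
    show "qprod s (a + 2 * b * j) (2 * b) * qprod s (a + b + 2 * b * j) (2 * b) =
      ((1 + s * fps_X ^ (a + 2 * b * j)) * (1 + s * fps_X ^ (a + b + 2 * b * j))) *
      (qprod s (a + 2 * b * Suc j) (2 * b) * qprod s (a + b + 2 * b * Suc j) (2 * b))"
      by (subst (1 2) qprod_rec) (use b in \<open>simp_all add: algebra_simps\<close>)
    define A where "A = qprod s (a + 2 * b * j) (2 * b)"
    define B where "B = qprod s (a + b + 2 * b * j) (2 * b)"
    define C where "C = qprod s (a + 2 * b * j) b"
    have "C - A * B = (C - 1) + (A - 1) * (- B) + (B - 1) * (- 1)" by (simp add: algebra_simps)
    also have "fps_X ^ j dvd \<dots>"
      unfolding A_def B_def C_def
      by (intro dvd_add dvd_mult2 qprod_dvd) (use b in \<open>simp_all add: trans_le_add2\<close>)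
    finally show "fps_X ^ j dvd C - A * B" .
  qed
  thus ?thesis by simp
qed

lemma qprod_split3:
  assumes b: "b > 0"
  shows "qprod s a b = qprod s a (3 * b) * qprod s (a + b) (3 * b) * qprod s (a + 2 * b) (3 * b)"
proof -
  have "qprod s (a + 3 * b * 0) b = qprod s (a + 3 * b * 0) (3 * b) *
    qprod s (a + b + 3 * b * 0) (3 * b) * qprod s (a + 2 * b + 3 * b * 0) (3 * b)"
  proof (rule fps_eq_if_same_recurrence)
    fix j
    let ?c = "(1 + s * fps_X ^ (a + 3 * b * j)) * (1 + s * fps_X ^ (a + b + 3 * b * j)) *
      (1 + s * fps_X ^ (a + 2 * b + 3 * b * j))"
    show "qprod s (a + 3 * b * j) b = ?c * qprod s (a + 3 * b * Suc j) b"
      by (subst qprod_rec[OF b], subst qprod_rec[OF b], subst qprod_rec[OF b]) (simp add: algebra_simps)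
    show "qprod s (a + 3 * b * j) (3 * b) * qprod s (a + b + 3 * b * j) (3 * b) *
      qprod s (a + 2 * b + 3 * b * j) (3 * b) = ?c *
      (qprod s (a + 3 * b * Suc j) (3 * b) * qprod s (a + b + 3 * b * Suc j) (3 * b) *
       qprod s (a + 2 * b + 3 * b * Suc j) (3 * b))"
      by (subst (1 2 3) qprod_rec) (use b in \<open>simp_all add: algebra_simps\<close>)
    define A where "A = qprod s (a + 3 * b * j) (3 * b)"
    define B where "B = qprod s (a + b + 3 * b * j) (3 * b)"
    define C where "C = qprod s (a + 2 * b + 3 * b * j) (3 * b)"
    define D where "D = qprod s (a + 3 * b * j) b"
    have "D - A * B * C = (D - 1) + (A - 1) * (- (B * C)) + (B - 1) * (- C) + (C - 1) * (- 1)" by (simp add: algebra_simps)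
    also have "fps_X ^ j dvd \<dots>"
      unfolding A_def B_def C_def D_def
      by (intro dvd_add dvd_mult2 qprod_dvd) (use b in \<open>simp_all add: trans_le_add2\<close>)
    finally show "fps_X ^ j dvd D - A * B * C" .
  qed
  thus ?thesis by simp
qed

section \<open>Euler's expansion and Jacobi's two identities\<close>

lemma Suc_choose_two: "Suc m choose 2 = m + (m choose 2)"
  by (simp add: numeral_2_eq_2)

lemma choose_two_add: "(m + n choose 2) = (m choose 2) + (n choose 2) + m * n"
  by (induction m) (simp_all add: Suc_choose_two)

lemma double_choose_two: "n + 2 * (n choose 2) = n * n"
  by (induction n) (simp_all add: Suc_choose_two)

lemma le_choose_two: "m \<le> (m choose 2) + 1"
  by (induction m) (simp_all add: Suc_choose_two)

text \<open>The \<open>m\<close>-th term in Euler's expansion of the product of all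
  \<open>1 + s q^(a + b i)\<close>.\<close>

definition euler_term :: "int fps \<Rightarrow> nat \<Rightarrow> nat \<Rightarrow> nat \<Rightarrow> int fps" where
  "euler_term s a b m = fps_X ^ (a * m + b * (m choose 2)) * (s ^ m * inv_qfac b m)"

lemma summable_euler_term:
  assumes "b > 0"
  shows "fps_summable (euler_term s a b)"
proof (rule fps_summable_nat)
  show "m \<le> a * m + b * (m choose 2) + 1" for m
  proof -
    have "(m choose 2) \<le> b * (m choose 2)" using assms by simp
    thus ?thesis using le_choose_two[of m] by linarith
  qed
qed (simp add: euler_term_def)

text \<open>Raising \<open>a\<close> to \<open>a + b\<close> multiplies the \<open>m\<close>-th term
  by \<open>Q^m\<close>, so the difference carries \<open>1 - Q^m\<close>, which cancels the last
  factor of \<open>inv_qfac b m\<close>.\<close>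

lemma euler_rec:
  assumes b: "b > 0"
  shows "fps_Sum (euler_term s a b) = (1 + s * fps_X ^ a) * fps_Sum (euler_term s (a + b) b)"
proof -
  define f where "f m = euler_term s a b m - euler_term s (a + b) b m" for m
  have f: "fps_summable f" unfolding f_def
    by (intro fps_summable_diff summable_euler_term b)
  have "fps_Sum (euler_term s a b) - fps_Sum (euler_term s (a + b) b) = fps_Sum f"
    unfolding f_def by (rule fps_Sum_diff[symmetric]; intro summable_euler_term b)
  also have "\<dots> = f 0 + fps_Sum (\<lambda>m. f (Suc m))" by (rule fps_Sum_Suc[OF f])
  also have "f 0 = 0" by (simp add: f_def euler_term_def)
  also have "(\<lambda>m. f (Suc m)) = (\<lambda>m. (s * fps_X ^ a) * euler_term s (a + b) b m)"
  proof
    fix m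
    have e: "fps_X ^ (a * Suc m + b * (Suc m choose 2)) =
        fps_X ^ a * (fps_X ^ ((a + b) * m + b * (m choose 2)) :: int fps)"
      "fps_X ^ ((a + b) * Suc m + b * (Suc m choose 2)) =
        fps_X ^ a * fps_X ^ ((a + b) * m + b * (m choose 2)) * (fps_X ^ (b * Suc m) :: int fps)"
      by (simp_all add: Suc_choose_two algebra_simps flip: power_add)
    have "f (Suc m) = s ^ Suc m * fps_X ^ a * fps_X ^ ((a + b) * m + b * (m choose 2)) *
      ((1 - fps_X ^ (b * Suc m)) * inv_qfac b (Suc m))"
      unfolding f_def euler_term_def e by (simp only: ring_distribs mult_ac) simp
    thus "f (Suc m) = (s * fps_X ^ a) * euler_term s (a + b) b m"
      unfolding inv_qfac_Suc[OF b] by (simp add: euler_term_def mult_ac)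
  qed
  also have "fps_Sum \<dots> = (s * fps_X ^ a) * fps_Sum (euler_term s (a + b) b)"
    by (rule fps_Sum_mult_left) (rule summable_euler_term[OF b])
  finally show ?thesis by (simp add: algebra_simps)
qed

lemma euler_dvd:
  assumes b: "b > 0" and "n \<le> a"
  shows "fps_X ^ n dvd fps_Sum (euler_term s a b) - 1"
  unfolding X_power_dvd_iff
proof (intro allI impI)
  fix i assume "i < n"
  have "fps_nth (fps_Sum (euler_term s a b)) i = fps_nth 1 i"
  proof (rule fps_Sum_mod_X_power[OF _ _ summable_euler_term[OF b]])
    show "euler_term s a b (Suc m) = fps_X ^ a *
      (fps_X ^ (a * m + b * (Suc m choose 2)) * (s ^ Suc m * inv_qfac b (Suc m)))" for m
      by (simp add: euler_term_def power_add mult_ac)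
  qed (use \<open>i < n\<close> \<open>n \<le> a\<close> in \<open>auto simp: euler_term_def numeral_2_eq_2\<close>)
  thus "fps_nth (fps_Sum (euler_term s a b) - 1) i = 0" by simp
qed

lemma euler_qprod:
  assumes b: "b > 0"
  shows "fps_Sum (euler_term s a b) = qprod s a b"
proof -
  have "fps_Sum (euler_term s (a + b * 0) b) = qprod s (a + b * 0) b"
  proof (rule fps_eq_if_same_recurrence)
    fix j
    have e: "a + b * Suc j = a + b * j + b" by simp
    show "fps_Sum (euler_term s (a + b * j) b) =
      (1 + s * fps_X ^ (a + b * j)) * fps_Sum (euler_term s (a + b * Suc j) b)"
      unfolding e by (rule euler_rec[OF b])
    show "qprod s (a + b * j) b = (1 + s * fps_X ^ (a + b * j)) * qprod s (a + b * Suc j) b"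
      unfolding e by (rule qprod_rec[OF b])
    have j: "j \<le> a + b * j" using b by (simp add: trans_le_add2)
    from dvd_diff[OF euler_dvd[OF b j] qprod_dvd[OF b j]]
    show "fps_X ^ j dvd fps_Sum (euler_term s (a + b * j) b) - qprod s (a + b * j) b"
      by simp
  qed
  thus ?thesis by simp
qed

lemma fps_Sum_diagonals:
  assumes "fps_summable (\<lambda>(m, l). F m l)"
  defines "G \<equiv> (\<lambda>(k :: int) l. if k \<ge> 0 then F (l + nat k) l else F l (l + nat (- k)))"
  shows "fps_summable (\<lambda>k. fps_Sum (G k))"
    "fps_Sum (\<lambda>(m, l). F m l) = fps_Sum (\<lambda>k. fps_Sum (G k))"
proof -
  define h :: "int \<times> nat \<Rightarrow> nat \<times> nat" where
    "h = (\<lambda>(k, l). if k \<ge> 0 then (l + nat k, l) else (l, l + nat (- k)))"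
  have h: "bij h"
  proof (rule o_bij)
    define g :: "nat \<times> nat \<Rightarrow> int \<times> nat" where "g = (\<lambda>(m, l). (int m - int l, min m l))"
    show "g \<circ> h = id" by (auto simp: g_def h_def fun_eq_iff)
    show "h \<circ> g = id" by (auto simp: g_def h_def fun_eq_iff)
  qed
  have GF: "(\<lambda>(k, l). G k l) = (\<lambda>x. case h x of (m, l) \<Rightarrow> F m l)"
    by (auto simp: G_def h_def fun_eq_iff)
  have "fps_summable (\<lambda>x. case h x of (m, l) \<Rightarrow> F m l)"
    by (rule fps_summable_reindex) (use h assms in \<open>simp_all add: bij_def\<close>)
  hence s: "fps_summable (\<lambda>(k, l). G k l)" by (simp add: GF)
  show "fps_summable (\<lambda>k. fps_Sum (G k))" by (rule fps_summable_Pair(2)[OF s])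
  have "fps_Sum (\<lambda>k. fps_Sum (G k)) = fps_Sum (\<lambda>(k, l). G k l)"
    by (rule fps_summable_Pair(3)[OF s])
  also have "\<dots> = fps_Sum (\<lambda>x. case h x of (m, l) \<Rightarrow> F m l)" by (simp add: GF)
  also have "\<dots> = fps_Sum (\<lambda>(m, l). F m l)" by (rule fps_Sum_reindex_bij[OF h])
  finally show "fps_Sum (\<lambda>(m, l). F m l) = fps_Sum (\<lambda>k. fps_Sum (G k))" ..
qed

text \<open>The term \<open>(s q^a)^k Q^(k(k-1)/2)\<close> with \<open>Q = q^b\<close>. For
  \<open>s * s = 1\<close> the power \<open>nat \<bar>k\<bar>\<close> of \<open>s\<close> stands for
  \<open>s^k\<close>, and for \<open>a \<le> b\<close> the exponent is nonnegative, so
  \<open>nat\<close> does not truncate.\<close>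

definition theta_term :: "int fps \<Rightarrow> nat \<Rightarrow> nat \<Rightarrow> int \<Rightarrow> int fps" where
  "theta_term s a b k = fps_X ^ nat (int a * k + int b * (k * (k - 1) div 2)) * s ^ nat \<bar>k\<bar>"

lemma choose_two_int:
  "int k * (int k - 1) div 2 = int (k choose 2)"
  "(- int k) * (- int k - 1) div 2 = int k + int (k choose 2)"
proof -
  have "k * (k - 1) div 2 = k choose 2" by (simp add: choose_two)
  hence "int (k * (k - 1) div 2) = int (k choose 2)" by simp
  thus *: "int k * (int k - 1) div 2 = int (k choose 2)"
    by (cases k) (simp_all add: zdiv_int algebra_simps)
  have "(- int k) * (- int k - 1) = int k * 2 + int k * (int k - 1)" by (simp add: algebra_simps)
  thus "(- int k) * (- int k - 1) div 2 = int k + int (k choose 2)" using * by simp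
qed

lemma theta_term_nonneg:
  "theta_term s a b (int k) = fps_X ^ (a * k + b * (k choose 2)) * s ^ k"
  unfolding theta_term_def choose_two_int by (simp add: nat_add_distrib nat_mult_distrib)

lemma theta_term_nonpos:
  assumes "a \<le> b"
  shows "theta_term s a b (- int k) = fps_X ^ ((b - a) * k + b * (k choose 2)) * s ^ k"
proof -
  obtain c where "b = a + c" using assms by (auto simp: le_iff_add)
  hence "int a * (- int k) + int b * (int k + int (k choose 2)) = int ((b - a) * k + b * (k choose 2))"
    by (simp add: algebra_simps)
  thus ?thesis
    unfolding theta_term_def choose_two_int by (simp only: nat_int abs_minus_cancel abs_of_nat)
qed

text \<open>Multiply the Euler series for \<open>a\<close> and \<open>b - a\<close>. On the diagonal
  \<open>k\<close> the powers of \<open>q\<close> separate into a theta term and a Durfee sum, the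
  sign \<open>s^(2l)\<close> is 1, and the Durfee sum is the reciprocal of
  \<open>qprod (-1) b b\<close> for every \<open>k\<close>.\<close>

theorem jacobi_triple_product:
  assumes b: "b > 0" and a: "a \<le> b" and s: "s * s = 1"
  shows "fps_summable (theta_term s a b)"
    "fps_Sum (theta_term s a b) = qprod s a b * qprod s (b - a) b * qprod (-1) b b"
proof -
  define F where "F m l = euler_term s a b m * euler_term s (b - a) b l" for m l
  define G where "G k l = (if k \<ge> 0 then F (l + nat k) l else F l (l + nat (- k)))" for k :: int and l
  have sF: "fps_summable (\<lambda>(m, l). F m l)"
    unfolding F_def by (intro fps_summable_mult_Pair summable_euler_term b)
  have ss: "s ^ (l + l) = 1" for l
    using s by (simp add: power_add flip: power_mult_distrib)
  have e: "a * (l + k) + b * (l + k choose 2) + ((b - a) * l + b * (l choose 2)) =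
      (a * k + b * (k choose 2)) + b * (l * (l + k))" if "a \<le> b" for a l k
  proof -
    have "a * (l + k) + b * (l + k choose 2) + ((b - a) * l + b * (l choose 2)) =
       (a * k + b * (k choose 2)) + (a + (b - a)) * l + b * (2 * (l choose 2)) + b * (l * k)"
      by (simp add: choose_two_add ring_distribs)
    also have "\<dots> = (a * k + b * (k choose 2)) + b * (l + 2 * (l choose 2)) + b * (l * k)"
      using that by (simp add: algebra_simps)
    also have "\<dots> = (a * k + b * (k choose 2)) + b * (l * (l + k))"
      unfolding double_choose_two by (simp add: algebra_simps)
    finally show ?thesis .
  qed
  have E: "euler_term s a b (l + k) * euler_term s (b - a) b l =
     (fps_X ^ (a * k + b * (k choose 2)) * s ^ k) *
       (fps_X ^ (b * (l * (l + k))) * (inv_qfac b l * inv_qfac b (l + k)))" if "a \<le> b" for a l k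
  proof -
    have "euler_term s a b (l + k) * euler_term s (b - a) b l =
      fps_X ^ (a * (l + k) + b * (l + k choose 2) + ((b - a) * l + b * (l choose 2))) *
        (s ^ k * s ^ (l + l) * (inv_qfac b l * inv_qfac b (l + k)))"
      by (simp only: euler_term_def power_add mult_ac)
    thus ?thesis unfolding e[OF that] ss by (simp only: power_add mult_ac mult_1_left)
  qed
  have GE: "G k l = theta_term s a b k *
    (fps_X ^ (b * (l * (l + nat \<bar>k\<bar>))) * (inv_qfac b l * inv_qfac b (l + nat \<bar>k\<bar>)))" for k l
  proof (cases "k \<ge> 0")
    case True
    then obtain j where "k = int j" by (rule nonneg_int_cases)
    thus ?thesis using E[OF a, of l j] by (simp add: G_def F_def theta_term_nonneg)
  next
    case False
    then obtain j where k: "k = - int j" by (metis nle_le nonpos_int_cases)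
    \<comment> \<open>Below the diagonal the two Euler series exchange their roles, so
      \<open>E\<close> is applied with \<open>b - a\<close> in place of \<open>a\<close>.\<close>
    have "b - (b - a) = a" using a by simp
    thus ?thesis using False E[of "b - a" l j]
      by (simp add: k G_def F_def theta_term_nonpos[OF a] mult_ac)
  qed
  have G: "fps_Sum (G k) = theta_term s a b k * durfee b 0" for k
    unfolding GE[abs_def]
    using fps_Sum_mult_left[OF summable_durfee[OF b], of "theta_term s a b k" "nat \<bar>k\<bar>"]
    by (simp add: durfee_const[OF b, of "nat \<bar>k\<bar>"] flip: durfee_def)
  have *: "fps_summable (\<lambda>k. theta_term s a b k * durfee b 0)"
    using fps_Sum_diagonals(1)[OF sF] unfolding G_def[symmetric] G .
  \<comment> \<open>Multiplying by the inverse of \<open>durfee b 0\<close> frees the theta terms,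
    so their summability follows from that of the double series.\<close>
  have "fps_summable (\<lambda>k. (theta_term s a b k * durfee b 0) * qprod (-1) b b)"
    using * by (rule fps_summable_mult_right)
  thus s: "fps_summable (theta_term s a b)"
    using durfee_qprod[OF b, of 0] by (simp add: mult.assoc)
  have "qprod s a b * qprod s (b - a) b = fps_Sum (\<lambda>(m, l). F m l)"
    unfolding F_def
    by (simp add: fps_Sum_product summable_euler_term b flip: euler_qprod[OF b])
  also have "\<dots> = fps_Sum (theta_term s a b) * durfee b 0"
    unfolding fps_Sum_diagonals(2)[OF sF] unfolding G_def[symmetric] G
    by (rule fps_Sum_mult_right[OF s])
  finally show "fps_Sum (theta_term s a b) = qprod s a b * qprod s (b - a) b * qprod (-1) b b"
    using durfee_qprod[OF b, of 0] by (simp add: mult.assoc)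
qed

text \<open>Squaring Euler's series for \<open>qprod (-1) b b\<close> and sorting by diagonals gives
  the sum of \<open>N \<bar>k\<bar>\<close> over all integers. By \<open>durfee_eq1\<close>,
  \<open>N k - N (Suc k)\<close> is a signed triangular power of \<open>Q\<close> times
  \<open>durfee b 0\<close>. Summation by parts with weights \<open>2 j + 1\<close>, whose
  increments are 2, yields \<open>N 0\<close> plus twice the later \<open>N k\<close>, which is the
  same bilateral sum.\<close>

theorem jacobi_cube:
  assumes b: "b > 0"
  defines "J \<equiv> (\<lambda>j. fps_X ^ (b * (Suc j choose 2)) * (of_nat (2 * j + 1) * (-1) ^ j) :: int fps)"
  shows "fps_summable J" "fps_Sum J = qprod (-1) b b ^ 3"
proof -
  define N where "N k = fps_X ^ (b * (Suc k choose 2)) * ((-1) ^ k * durfee' b k)" for k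
  have le: "k \<le> b * (Suc k choose 2) + 0" for k
  proof -
    have "k \<le> Suc k choose 2" by (simp add: Suc_choose_two)
    also have "\<dots> \<le> b * (Suc k choose 2)" using b by simp
    finally show ?thesis by simp
  qed
  have sN: "fps_summable (\<lambda>k. N k)"
    by (rule fps_summable_nat[OF _ le]) (simp add: N_def)
  have sN': "fps_summable (\<lambda>k. N (Suc k))"
    by (rule fps_summable_reindex[OF _ sN]) simp
  show sJ: "fps_summable J"
    by (rule fps_summable_nat[OF _ le]) (simp add: J_def)
  have soN: "fps_summable (\<lambda>k. of_nat (c k) * N k)" for c :: "nat \<Rightarrow> nat"
    by (rule fps_summable_nat[OF _ le, of _ "\<lambda>k. of_nat (c k) * ((-1) ^ k * durfee' b k)"])
      (simp add: N_def mult_ac)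
  have soN': "fps_summable (\<lambda>k. of_nat (c k) * N (Suc k))" for c :: "nat \<Rightarrow> nat"
    using fps_summable_reindex[of Suc, OF _ soN[of "\<lambda>k. c (k - 1)"]] by simp
  have N_rec: "N k - N (Suc k) = fps_X ^ (b * (Suc k choose 2)) * ((-1) ^ k * durfee b 0)" for k
  proof -
    have "N (Suc k) = - (fps_X ^ (b * (Suc k choose 2)) * ((-1) ^ k * (fps_X ^ (b * Suc k) * durfee' b (Suc k))))"
    proof -
      have "fps_X ^ (b * (Suc (Suc k) choose 2)) =
        fps_X ^ (b * (Suc k choose 2)) * (fps_X ^ (b * Suc k) :: int fps)"
        by (simp add: Suc_choose_two[of "Suc k"] add_mult_distrib2 add_ac flip: power_add)
      thus ?thesis by (simp add: N_def mult_ac)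
    qed
    thus ?thesis
      using durfee_eq1[OF b, of k] durfee_const[OF b, of k]
      by (simp add: N_def algebra_simps)
  qed
  have "fps_Sum J * durfee b 0 = fps_Sum (\<lambda>j. J j * durfee b 0)"
    by (rule fps_Sum_mult_right[OF sJ, symmetric])
  also have "(\<lambda>j. J j * durfee b 0) = (\<lambda>j. of_nat (2 * j + 1) * N j - of_nat (2 * j + 1) * N (Suc j))"
  proof
    fix j
    have "J j * durfee b 0 = of_nat (2 * j + 1) * (N j - N (Suc j))"
      unfolding N_rec J_def by (simp only: mult_ac)
    thus "J j * durfee b 0 = of_nat (2 * j + 1) * N j - of_nat (2 * j + 1) * N (Suc j)"
      by (simp only: right_diff_distrib)
  qed
  also have "fps_Sum \<dots> = fps_Sum (\<lambda>j. of_nat (2 * j + 1) * N j) - fps_Sum (\<lambda>j. of_nat (2 * j + 1) * N (Suc j))"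
    by (rule fps_Sum_diff[OF soN soN'])
  also have "fps_Sum (\<lambda>j. of_nat (2 * j + 1) * N j) = N 0 + fps_Sum (\<lambda>j. of_nat (2 * Suc j + 1) * N (Suc j))"
    by (subst fps_Sum_Suc[OF soN]) simp
  also have "\<dots> - fps_Sum (\<lambda>j. of_nat (2 * j + 1) * N (Suc j)) =
     N 0 + fps_Sum (\<lambda>j. of_nat (2 * Suc j + 1) * N (Suc j) - of_nat (2 * j + 1) * N (Suc j))"
    by (subst fps_Sum_diff[OF soN' soN']) simp
  also have "(\<lambda>j. of_nat (2 * Suc j + 1) * N (Suc j) - of_nat (2 * j + 1) * N (Suc j)) =
     (\<lambda>j. N (Suc j) + N (Suc j))"
    by (simp add: algebra_simps)
  also have "N 0 + fps_Sum \<dots> = fps_Sum N + fps_Sum (\<lambda>j. N (Suc j))"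
    by (simp add: fps_Sum_mult_left[OF sN'] fps_Sum_Suc[OF sN])
  finally have J: "fps_Sum J * durfee b 0 = fps_Sum N + fps_Sum (\<lambda>j. N (Suc j))" .

  define F where "F m l = euler_term (-1) b b m * euler_term (-1) b b l" for m l
  define G where "G k l = (if k \<ge> 0 then F (l + nat k) l else F l (l + nat (- k)))" for k :: int and l
  have sF: "fps_summable (\<lambda>(m, l). F m l)"
    unfolding F_def by (intro fps_summable_mult_Pair summable_euler_term b)
  have E: "euler_term (-1) b b (l + k) * euler_term (-1) b b l =
     (fps_X ^ (b * (Suc k choose 2)) * (-1) ^ k) *
       (fps_X ^ (b * (l * (l + k) + l)) * (inv_qfac b l * inv_qfac b (l + k)))" for l k
  proof -
    have "b * (l + k) + b * (l + k choose 2) + (b * l + b * (l choose 2)) =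
      b * (k + (k choose 2)) + b * (l + 2 * (l choose 2) + l * k + l)"
      by (simp add: choose_two_add algebra_simps)
    also have "\<dots> = b * (Suc k choose 2) + b * (l * (l + k) + l)"
      unfolding double_choose_two by (simp add: Suc_choose_two algebra_simps)
    finally have e: "b * (l + k) + b * (l + k choose 2) + (b * l + b * (l choose 2)) =
      b * (Suc k choose 2) + b * (l * (l + k) + l)" .
    have "euler_term (-1) b b (l + k) * euler_term (-1) b b l =
      fps_X ^ (b * (l + k) + b * (l + k choose 2) + (b * l + b * (l choose 2))) *
        ((-1) ^ k * (-1) ^ (l + l) * (inv_qfac b l * inv_qfac b (l + k)))"
      by (simp only: euler_term_def power_add mult_ac)
    thus ?thesis unfolding e by (simp add: power_add mult_ac)
  qed
  have GE: "G k l = (fps_X ^ (b * (Suc (nat \<bar>k\<bar>) choose 2)) * (-1) ^ nat \<bar>k\<bar>) *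
    (fps_X ^ (b * (l * (l + nat \<bar>k\<bar>) + l)) * (inv_qfac b l * inv_qfac b (l + nat \<bar>k\<bar>)))" for k l
    using E[of l "nat \<bar>k\<bar>"] by (cases "k \<ge> 0") (simp_all add: G_def F_def mult.commute)
  have G: "fps_Sum (G k) = N (nat \<bar>k\<bar>)" for k
    unfolding GE[abs_def]
    using fps_Sum_mult_left[OF summable_durfee'[OF b],
        of "fps_X ^ (b * (Suc (nat \<bar>k\<bar>) choose 2)) * (-1) ^ nat \<bar>k\<bar>" "nat \<bar>k\<bar>"]
    by (simp add: N_def mult.assoc flip: durfee'_def)
  have "qprod (-1) b b * qprod (-1) b b = fps_Sum (\<lambda>(m, l). F m l)"
    unfolding F_def
    by (simp add: fps_Sum_product summable_euler_term b flip: euler_qprod[OF b])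
  also have "\<dots> = fps_Sum (\<lambda>k :: int. N (nat \<bar>k\<bar>))"
    unfolding fps_Sum_diagonals(2)[OF sF] unfolding G_def[symmetric] G ..
  also have "\<dots> = fps_Sum N + fps_Sum (\<lambda>j. N (Suc j))"
  proof (subst fps_Sum_int)
    show "fps_summable (\<lambda>k :: int. N (nat \<bar>k\<bar>))"
      using fps_Sum_diagonals(1)[OF sF] unfolding G_def[symmetric] G .
    have "nat \<bar>- 1 - int n\<bar> = Suc n" for n by simp
    thus "fps_Sum (\<lambda>n. N (nat \<bar>int n\<bar>)) + fps_Sum (\<lambda>n. N (nat \<bar>- 1 - int n\<bar>)) =
      fps_Sum N + fps_Sum (\<lambda>j. N (Suc j))" by simp
  qed
  finally have "fps_Sum J * durfee b 0 * qprod (-1) b b = qprod (-1) b b ^ 3"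
    using J by (simp add: power3_eq_cube)
  thus "fps_Sum J = qprod (-1) b b ^ 3"
    using durfee_qprod[OF b, of 0] by (simp add: mult.assoc)
qed

section \<open>The Appell--Lerch form of \<open>\<xi>\<close>\<close>

text \<open>
  After multiplication by \<open>1 - Q\<^sup>N\<close>, \<open>Q = q\<^sup>6\<close>, the sum telescopes, because very-well-poised
  series of this type are indefinitely summable; \<open>C\<close> below is the antidifference.
\<close>

lemma well_poised_sum_eq_0:
  assumes "N > 0"
  shows "(\<Sum>t\<le>N. (-1) ^ t * fps_X ^ (6 * (t choose 2)) * (1 - fps_X ^ (12 * t + 6)) *
    (inv_qfac 6 (N - t) * inv_qfac 6 (N + t + 1))) = 0"
proof -
  define s where "s t = (-1) ^ t * fps_X ^ (6 * (t choose 2)) * (1 - fps_X ^ (12 * t + 6)) *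
    (inv_qfac 6 (N - t) * inv_qfac 6 (N + t + 1))" for t
  define C where "C t = (-1) ^ t * fps_X ^ (6 * (Suc t choose 2)) * (1 - fps_X ^ (6 * Suc t)) *
    (inv_qfac 6 (N - Suc t) * inv_qfac 6 (N + t + 1))" for t
  have iq: "inv_qfac 6 (N - Suc t) = (1 - fps_X ^ (6 * (N - t))) * inv_qfac 6 (N - t)" if "t < N" for t
    using inv_qfac_Suc[of 6 "N - Suc t"] that by (simp add: Suc_diff_Suc del: mult_Suc_right)
  have iq': "inv_qfac 6 (N + t + 1) = (1 - fps_X ^ (6 * (N + t + 2))) * inv_qfac 6 (N + t + 2)" for t
    using inv_qfac_Suc[of 6 "N + t + 1"] by (simp del: mult_Suc_right)
  \<comment> \<open>At \<open>T = N\<close> the subtraction in \<open>C\<close> truncates, whereas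
    the true antidifference vanishes there, \<open>1 / (Q; Q)\<close> of index -1 being 0. The last
    summand is therefore treated separately and cancels \<open>C (N - 1)\<close>.\<close>
  have partial: "(1 - fps_X ^ (6 * N)) * (\<Sum>t\<le>T. s t) = C T" if "T < N" for T
    using that
  proof (induction T)
    case 0
    show ?case using iq[OF assms] by (simp add: s_def C_def numeral_2_eq_2 mult_ac)
  next
    case (Suc T)
    define A where "A = inv_qfac 6 (N - Suc T)"
    define B where "B = inv_qfac 6 (N + T + 2)"
    define x :: "int fps" where "x = fps_X ^ (6 * Suc T)"
    define y :: "int fps" where "y = fps_X ^ (6 * (N - Suc T))"
    have xy: "fps_X ^ (6 * N) = x * y"
      using Suc.prems unfolding x_def y_def by (simp flip: power_add)
    have e: "fps_X ^ (6 * (Suc (Suc T) choose 2)) = x * fps_X ^ (6 * (Suc T choose 2))"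
      "fps_X ^ (12 * Suc T + 6) = x * x * fps_X ^ 6"
      "fps_X ^ (6 * (N + T + 2)) = x * y * (x * fps_X ^ 6)"
      "fps_X ^ (6 * Suc (Suc T)) = x * fps_X ^ 6"
      using Suc.prems unfolding xy[symmetric] unfolding x_def
      by (simp_all add: Suc_choose_two[of "Suc T"] algebra_simps flip: power_add)
    have "(1 - fps_X ^ (6 * N)) * (\<Sum>t\<le>Suc T. s t) = C T + (1 - fps_X ^ (6 * N)) * s (Suc T)"
      using Suc by (simp add: ring_distribs)
    also have "C T = (-1) ^ T * fps_X ^ (6 * (Suc T choose 2)) * (1 - x) *
      (A * ((1 - x * y * (x * fps_X ^ 6)) * B))"
      unfolding C_def A_def B_def x_def[symmetric] iq'[of T] unfolding e(3) ..
    also have "s (Suc T) = - ((-1) ^ T * fps_X ^ (6 * (Suc T choose 2)) * (1 - x * x * fps_X ^ 6) * (A * B))"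
      unfolding s_def A_def B_def e by (simp add: numeral_2_eq_2)
    also have "(-1) ^ T * fps_X ^ (6 * (Suc T choose 2)) * (1 - x) *
      (A * ((1 - x * y * (x * fps_X ^ 6)) * B)) +
      (1 - fps_X ^ (6 * N)) * - ((-1) ^ T * fps_X ^ (6 * (Suc T choose 2)) * (1 - x * x * fps_X ^ 6) * (A * B))
      = - ((-1) ^ T * (x * fps_X ^ (6 * (Suc T choose 2))) * (1 - x * fps_X ^ 6) * ((1 - y) * A * B))"
      unfolding xy by (simp add: algebra_simps)
    also have "\<dots> = C (Suc T)"
      unfolding C_def e iq[OF Suc.prems] A_def B_def y_def by (simp add: numeral_2_eq_2 mult_ac)
    finally show ?case .
  qed
  obtain M where M: "N = Suc M" using assms by (cases N) auto
  have "(1 - fps_X ^ (6 * N)) * (\<Sum>t\<le>N. s t) = C M + (1 - fps_X ^ (6 * N)) * s N"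
    using partial[of M] by (simp add: M ring_distribs)
  also have "C M = - ((-1) ^ N * fps_X ^ (6 * (N choose 2)) * (1 - fps_X ^ (6 * N)) * inv_qfac 6 (2 * N))"
    by (simp add: C_def M mult_2)
  also have "s N = (-1) ^ N * fps_X ^ (6 * (N choose 2)) * inv_qfac 6 (2 * N)"
  proof -
    have "12 * N + 6 = 6 * Suc (2 * N)" by simp
    thus ?thesis
      using inv_qfac_Suc[of 6 "2 * N"] by (simp add: s_def mult_2 mult.assoc del: mult_Suc_right)
  qed
  finally have "(1 - fps_X ^ (6 * N)) * (\<Sum>t\<le>N. s t) = 0" by simp
  moreover have "fps_nth (1 - fps_X ^ (6 * N) :: int fps) 0 \<noteq> 0"
    using assms by simp
  hence "1 - fps_X ^ (6 * N) \<noteq> (0 :: int fps)" by (metis fps_zero_nth)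
  ultimately show ?thesis unfolding s_def by simp
qed

text \<open>
  The poles \<open>x = Q\<^bsup>-t\<^esup>\<close> and \<open>x = Q\<^bsup>t+1\<^esup>\<close> of \<open>1 / ((x; Q)\<^sub>n\<^sub>+\<^sub>1 (Q/x; Q)\<^sub>n\<^sub>+\<^sub>1)\<close>, taken together and
  specialised to \<open>x = q\<close>, contribute \<open>lambert_factor t\<close> to the partial fraction expansion.
\<close>

definition lambert_factor :: "nat \<Rightarrow> int fps" where
  "lambert_factor t = (1 - fps_X ^ (12 * t + 6)) * (geom (6 * t + 1) * geom (6 * t + 5))"

text \<open>The two summands are the terms \<open>r = t\<close> and \<open>r = - t - 1\<close> of
  the bilateral Appell-Lerch sum, which have the same Gaussian factor.\<close>

lemma lambert_factor_eq: "lambert_factor t = geom (6 * t + 1) + fps_X ^ (6 * t + 5) * geom (6 * t + 5)"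
proof -
  have "fps_X ^ (12 * t + 6) = fps_X ^ (6 * t + 5) * (fps_X ^ (6 * t + 1) :: int fps)"
    unfolding power_add[symmetric] by (rule arg_cong[of _ _ "\<lambda>n. fps_X ^ n"]) simp
  hence "1 - fps_X ^ (12 * t + 6) =
      (1 - fps_X ^ (6 * t + 5)) + fps_X ^ (6 * t + 5) * (1 - fps_X ^ (6 * t + 1) :: int fps)"
    by (simp only: ring_distribs) simp
  hence "lambert_factor t = ((1 - fps_X ^ (6 * t + 5)) * geom (6 * t + 5)) * geom (6 * t + 1) +
      fps_X ^ (6 * t + 5) * ((1 - fps_X ^ (6 * t + 1)) * geom (6 * t + 1)) * geom (6 * t + 5)"
    by (simp add: lambert_factor_def algebra_simps)
  thus ?thesis by (subst (asm) (1 2) geom_mult) simp_all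
qed

definition partial_fraction :: "nat \<Rightarrow> int fps" where
  "partial_fraction n = (\<Sum>t\<le>n. (-1) ^ t * fps_X ^ (6 * (Suc t choose 2)) *
     (inv_qfac 6 (n - t) * inv_qfac 6 (n + t + 1)) * lambert_factor t)"

text \<open>Going from \<open>n\<close> to \<open>n + 1\<close> divides by two factors. Multiplying
  them back reproduces the old terms up to \<open>Q^N s t\<close>, and these errors sum to 0 by
  \<open>well_poised_sum_eq_0\<close>.\<close>

lemma partial_fraction_Suc:
  "(1 - fps_X ^ (6 * n + 7)) * (1 - fps_X ^ (6 * n + 11)) * partial_fraction (Suc n) = partial_fraction n"
proof -
  define N where "N = Suc n"
  define P :: "int fps" where "P = (1 - fps_X ^ (6 * n + 7)) * (1 - fps_X ^ (6 * n + 11))"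
  define f where "f m t = (-1) ^ t * fps_X ^ (6 * (Suc t choose 2)) *
     (inv_qfac 6 (m - t) * inv_qfac 6 (m + t + 1)) * lambert_factor t" for m t
  define s where "s t = (-1) ^ t * fps_X ^ (6 * (t choose 2)) * (1 - fps_X ^ (12 * t + 6)) *
    (inv_qfac 6 (N - t) * inv_qfac 6 (N + t + 1))" for t
  have "P * f N t = (if t = N then 0 else f n t) + fps_X ^ (6 * N) * s t" if t: "t \<le> N" for t
  proof -
    define x :: "int fps" where "x = fps_X ^ (6 * t)"
    define y :: "int fps" where "y = fps_X ^ (6 * (N - t))"
    have xy: "fps_X ^ (6 * N) = x * y"
      using t unfolding x_def y_def by (simp flip: power_add)
    have e: "fps_X ^ (6 * n + 7) = x * y * fps_X" "fps_X ^ (6 * n + 11) = x * y * fps_X ^ 5"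
      unfolding xy[symmetric] N_def by (simp_all add: algebra_simps flip: power_add power_Suc)
    \<comment> \<open>The first product lowers both reciprocals from \<open>N\<close> to
      \<open>n\<close> and vanishes for \<open>t = N\<close>, where \<open>y = 1\<close>. The second
      cancels both denominators of \<open>lambert_factor t\<close> and leaves the error
      term.\<close>
    have P: "P = (1 - y) * (1 - x * y * (x * fps_X ^ 6)) +
        y * ((1 - x * fps_X) * (1 - x * fps_X ^ 5))"
      unfolding P_def e by (simp add: algebra_simps eval_nat_numeral)
    have g: "(1 - x * fps_X) * (1 - x * fps_X ^ 5) * lambert_factor t = 1 - fps_X ^ (12 * t + 6)"
    proof -
      have "(1 - x * fps_X) * (1 - x * fps_X ^ 5) * lambert_factor t =
        (1 - fps_X ^ (12 * t + 6)) * (((1 - fps_X ^ (6 * t + 1)) * geom (6 * t + 1)) *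
          ((1 - fps_X ^ (6 * t + 5)) * geom (6 * t + 5)))"
        by (simp add: lambert_factor_def x_def power_add mult_ac)
      thus ?thesis by (subst (asm) (1 2) geom_mult) simp_all
    qed
    have q: "(1 - y) * (1 - x * y * (x * fps_X ^ 6)) * (inv_qfac 6 (N - t) * inv_qfac 6 (N + t + 1))
      = (if t = N then 0 else inv_qfac 6 (n - t) * inv_qfac 6 (n + t + 1))"
    proof (cases "t = N")
      case False
      have 1: "(1 - y) * inv_qfac 6 (N - t) = inv_qfac 6 (n - t)"
        using inv_qfac_Suc[of 6 "n - t"] t False
        unfolding y_def N_def by (simp add: Suc_diff_le del: mult_Suc_right)
      have "x * y * (x * fps_X ^ 6) = fps_X ^ (6 * Suc (N + t))"
        unfolding xy[symmetric] unfolding x_def by (simp add: algebra_simps flip: power_add)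
      hence 2: "(1 - x * y * (x * fps_X ^ 6)) * inv_qfac 6 (N + t + 1) = inv_qfac 6 (n + t + 1)"
        using inv_qfac_Suc[of 6 "N + t"] by (simp add: N_def del: mult_Suc_right)
      show ?thesis using False unfolding 1[symmetric] 2[symmetric] by (simp only: if_False mult_ac)
    qed (simp add: y_def)
    have c: "fps_X ^ (6 * (Suc t choose 2)) * y = fps_X ^ (6 * N) * (fps_X ^ (6 * (t choose 2)) :: int fps)"
      unfolding xy unfolding x_def by (simp add: Suc_choose_two algebra_simps flip: power_add)
    have "P * f N t = (-1) ^ t * fps_X ^ (6 * (Suc t choose 2)) * lambert_factor t *
       ((1 - y) * (1 - x * y * (x * fps_X ^ 6)) * (inv_qfac 6 (N - t) * inv_qfac 6 (N + t + 1))) +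
       (-1) ^ t * (fps_X ^ (6 * (Suc t choose 2)) * y) *
        ((1 - x * fps_X) * (1 - x * fps_X ^ 5) * lambert_factor t) *
        (inv_qfac 6 (N - t) * inv_qfac 6 (N + t + 1))"
      unfolding P f_def by (simp only: ring_distribs mult_ac)
    also have "\<dots> = (if t = N then 0 else f n t) + fps_X ^ (6 * N) * s t"
      unfolding q g c f_def s_def by (simp add: mult_ac)
    finally show ?thesis .
  qed
  hence "P * partial_fraction N = (\<Sum>t\<le>N. (if t = N then 0 else f n t) + fps_X ^ (6 * N) * s t)"
    unfolding partial_fraction_def f_def sum_distrib_left by (intro sum.cong) auto
  also have "\<dots> = (\<Sum>t\<le>N. if t = N then 0 else f n t) + fps_X ^ (6 * N) * (\<Sum>t\<le>N. s t)"
    by (simp add: sum.distrib sum_distrib_left)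
  also have "(\<Sum>t\<le>N. s t) = 0" unfolding s_def by (rule well_poised_sum_eq_0) (simp add: N_def)
  also have "(\<Sum>t\<le>N. if t = N then 0 else f n t) = (\<Sum>t\<le>n. f n t)"
    unfolding N_def by (simp add: sum.neutral)
  finally show ?thesis by (simp add: P_def N_def f_def partial_fraction_def)
qed

lemma xi_denom_partial_fraction: "xi_denom (Suc n) * partial_fraction n = 1"
proof (induction n)
  case 0
  have "xi_denom (Suc 0) * partial_fraction 0 = ((1 - fps_X ^ (6 * Suc 0)) * inv_qfac 6 (Suc 0)) *
     (((1 - fps_X ^ 1) * geom 1) * ((1 - fps_X ^ 5) * geom 5))"
    by (simp add: xi_denom_def q_pochhammer_def partial_fraction_def lambert_factor_def mult_ac numeral_2_eq_2)
  thus ?case by (subst (asm) inv_qfac_Suc, simp, subst (asm) (1 2) geom_mult) simp_all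
next
  case (Suc n)
  have "xi_denom (Suc (Suc n)) = xi_denom (Suc n) * ((1 - fps_X ^ (6 * n + 7)) * (1 - fps_X ^ (6 * n + 11)))"
  proof -
    have "fps_X * (fps_X ^ 6) ^ Suc n = (fps_X ^ (6 * n + 7) :: int fps)"
      "fps_X ^ 5 * (fps_X ^ 6) ^ Suc n = (fps_X ^ (6 * n + 11) :: int fps)"
      by (simp_all add: algebra_simps flip: power_add power_mult power_Suc)
    moreover have "xi_denom (Suc (Suc n)) = xi_denom (Suc n) *
      ((1 - fps_X * (fps_X ^ 6) ^ Suc n) * (1 - fps_X ^ 5 * (fps_X ^ 6) ^ Suc n))"
      unfolding xi_denom_def q_pochhammer_def prod.lessThan_Suc[of _ "Suc n"] by (simp only: mult_ac)
    ultimately show ?thesis by metis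
  qed
  thus ?case using Suc partial_fraction_Suc[of n] by (simp add: mult.assoc)
qed

lemma xi_term_eq: "xi_term (Suc n) = fps_X ^ (6 * n ^ 2 + 6 * n + 1) * partial_fraction n"
proof -
  have "fps_right_inverse (xi_denom (Suc n)) 1 =
      fps_right_inverse (xi_denom (Suc n)) 1 * (xi_denom (Suc n) * partial_fraction n)"
    by (simp add: xi_denom_partial_fraction)
  also have "\<dots> = (xi_denom (Suc n) * fps_right_inverse (xi_denom (Suc n)) 1) * partial_fraction n"
    by (simp only: mult_ac)
  finally have "fps_right_inverse (xi_denom (Suc n)) 1 = partial_fraction n"
    by (simp add: xi_denom_inverse)
  moreover have "6 * Suc n ^ 2 - 6 * Suc n + 1 = 6 * n ^ 2 + 6 * n + 1"
    by (simp add: power2_eq_square)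
  ultimately show ?thesis unfolding xi_term_def by metis
qed

lemma xi_eq_fps_Sum: "xi = 1 + 2 * fps_Sum (\<lambda>n. xi_term (Suc n))"
proof -
  have "(\<Sum>n. xi_term (Suc n)) = fps_Sum (\<lambda>n. xi_term (Suc n))"
  proof (rule fps_ext)
    fix m
    have "fps_nth (fps_Sum (\<lambda>n. xi_term (Suc n))) m = (\<Sum>n\<le>m. fps_nth (xi_term (Suc n)) m)"
      by (rule fps_Sum_nth) (use xi_term_nth_eq_0 not_le in \<open>auto simp del: One_nat_def\<close>)
    thus "fps_nth (\<Sum>n. xi_term (Suc n)) m = fps_nth (fps_Sum (\<lambda>n. xi_term (Suc n))) m"
      using sums_unique[OF xi_term_sums, symmetric] by simp
  qed
  thus ?thesis unfolding xi_def by simp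
qed

lemma fps_Sum_triangle:
  fixes H :: "nat \<Rightarrow> nat \<Rightarrow> int fps"
  assumes "fps_summable (\<lambda>(t, m). H t m)"
  shows "fps_Sum (\<lambda>n. \<Sum>t\<le>n. H t (n - t)) = fps_Sum (\<lambda>t. fps_Sum (H t))"
proof -
  define h :: "nat \<times> nat \<Rightarrow> nat \<times> nat" where "h = (\<lambda>(t, m). (t + m, t))"
  define F where "F n t = (if t \<le> n then H t (n - t) else 0)" for n t
  have h: "inj h" by (auto simp: h_def inj_on_def)
  have range: "x \<in> range h" if "snd x \<le> fst x" for x
    using that by (intro image_eqI[of _ _ "(snd x, fst x - snd x)"]) (auto simp: h_def)
  have HF: "(\<lambda>(t, m). H t m) = (\<lambda>x. case h x of (n, t) \<Rightarrow> F n t)"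
    by (auto simp: h_def F_def fun_eq_iff)
  have s: "fps_summable (\<lambda>(n, t). F n t)"
  proof (rule fps_summableI)
    show "finite (h ` {x. fps_nth (case x of (t, m) \<Rightarrow> H t m) n \<noteq> 0})" for n
      using fps_summableD[OF assms] by blast
    show "x \<in> h ` {x. fps_nth (case x of (t, m) \<Rightarrow> H t m) n \<noteq> 0}"
      if "fps_nth (case x of (n, t) \<Rightarrow> F n t) n \<noteq> 0" for n x
    proof -
      have "snd x \<le> fst x" using that by (auto simp: F_def split: if_splits prod.splits)
      then obtain y where "x = h y" using range by blast
      thus ?thesis using that unfolding HF by blast
    qed
  qed
  have "fps_Sum (\<lambda>t. fps_Sum (H t)) = fps_Sum (\<lambda>(t, m). H t m)"
    by (rule fps_summable_Pair(3)[OF assms])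
  also have "\<dots> = fps_Sum (\<lambda>(n, t). F n t)"
    unfolding HF
  proof (rule fps_Sum_reindex[OF h])
    show "(case x of (n, t) \<Rightarrow> F n t) = 0" if "x \<notin> range h" for x
      using that range[of x] by (auto simp: F_def split: prod.splits)
  qed
  also have "\<dots> = fps_Sum (\<lambda>n. fps_Sum (F n))"
    by (rule fps_summable_Pair(3)[OF s, symmetric])
  also have "(\<lambda>n. fps_Sum (F n)) = (\<lambda>n. \<Sum>t\<le>n. H t (n - t))"
  proof
    fix n
    have "fps_Sum (F n) = sum (F n) {..n}" by (rule fps_Sum_finite) (auto simp: F_def)
    thus "fps_Sum (F n) = (\<Sum>t\<le>n. H t (n - t))" by (simp add: F_def)
  qed
  finally show ?thesis by simp
qed

text \<open>With \<open>n = t + m\<close> the exponent separates into \<open>9 t^2 + 9 t + 1\<close>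
  and \<open>6 m (m + 2 t + 1)\<close>. The sum over \<open>m\<close> is thus a Durfee sum of
  difference \<open>2 t + 1\<close>, whose value is the same for all \<open>t\<close>.\<close>

theorem xi_appell_lerch:
  defines "A \<equiv> (\<lambda>t. fps_X ^ (9 * t ^ 2 + 9 * t + 1) * ((-1) ^ t * lambert_factor t))"
  shows "fps_summable A" "(xi - 1) * qprod (-1) 6 6 = 2 * fps_Sum A"
proof -
  define B where "B k m = fps_X ^ (6 * (m * (m + k))) * (inv_qfac 6 m * inv_qfac 6 (m + k))" for k m
  show A: "fps_summable A"
  proof (rule fps_summable_nat)
    show "A t = fps_X ^ (9 * t ^ 2 + 9 * t + 1) * ((-1) ^ t * lambert_factor t)" for t
      by (simp only: A_def)
    show "t \<le> 9 * t ^ 2 + 9 * t + 1 + 0" for t :: nat by simp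
  qed
  have B: "fps_summable (B k)" for k
    unfolding B_def by (rule summable_durfee) simp
  have AB: "fps_summable (\<lambda>(t, m). A t * B (2 * t + 1) m)"
    by (intro fps_summable_mult_Pair A B)
  have "fps_Sum (\<lambda>n. xi_term (Suc n)) = fps_Sum (\<lambda>n. \<Sum>t\<le>n. A t * B (2 * t + 1) (n - t))"
  proof (rule arg_cong[of _ _ fps_Sum], rule ext)
    fix n
    show "xi_term (Suc n) = (\<Sum>t\<le>n. A t * B (2 * t + 1) (n - t))"
      unfolding xi_term_eq partial_fraction_def sum_distrib_left
    proof (rule sum.cong[OF refl])
      fix t assume "t \<in> {..n}"
      then obtain m where n: "n = t + m" by (auto simp: le_iff_add)
      have c: "2 * (Suc t choose 2) = t ^ 2 + t"
        by (induction t) (simp_all add: Suc_choose_two[of "Suc _"] power2_eq_square numeral_2_eq_2)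
      have "6 * n ^ 2 + 6 * n + 1 + 6 * (Suc t choose 2) =
        6 * (t + m) ^ 2 + 6 * (t + m) + 1 + 3 * (2 * (Suc t choose 2))"
        by (simp add: n)
      also have "\<dots> = (9 * t ^ 2 + 9 * t + 1) + 6 * (m * (m + (2 * t + 1)))"
        unfolding c by (simp add: power2_eq_square algebra_simps)
      finally have e: "6 * n ^ 2 + 6 * n + 1 + 6 * (Suc t choose 2) =
        (9 * t ^ 2 + 9 * t + 1) + 6 * (m * (m + (2 * t + 1)))" .
      have "fps_X ^ (6 * n ^ 2 + 6 * n + 1) * ((-1) ^ t * fps_X ^ (6 * (Suc t choose 2)) *
         (inv_qfac 6 (n - t) * inv_qfac 6 (n + t + 1)) * lambert_factor t) =
         fps_X ^ (6 * n ^ 2 + 6 * n + 1 + 6 * (Suc t choose 2)) * ((-1) ^ t *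
         (inv_qfac 6 (n - t) * inv_qfac 6 (n + t + 1)) * lambert_factor t)"
        unfolding power_add[of _ _ "6 * (Suc t choose 2)"] by (simp only: mult_ac)
      also have "\<dots> = A t * B (2 * t + 1) (n - t)"
      proof -
        have "n + t + 1 = m + (2 * t + 1)" "n - t = m" by (simp_all add: n)
        thus ?thesis unfolding e A_def B_def power_add[of _ "9 * t ^ 2 + 9 * t + 1"]
          by (simp only: mult_ac)
      qed
      finally show "fps_X ^ (6 * n ^ 2 + 6 * n + 1) * ((-1) ^ t * fps_X ^ (6 * (Suc t choose 2)) *
         (inv_qfac 6 (n - t) * inv_qfac 6 (n + t + 1)) * lambert_factor t) = A t * B (2 * t + 1) (n - t)" .
    qed
  qed
  also have "\<dots> = fps_Sum (\<lambda>t. fps_Sum (\<lambda>m. A t * B (2 * t + 1) m))"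
    by (rule fps_Sum_triangle[OF AB])
  also have "(\<lambda>t. fps_Sum (\<lambda>m. A t * B (2 * t + 1) m)) = (\<lambda>t. A t * durfee 6 0)"
  proof
    fix t
    have "fps_Sum (B (2 * t + 1)) = durfee 6 (2 * t + 1)"
      unfolding durfee_def B_def[abs_def] ..
    hence "fps_Sum (B (2 * t + 1)) = durfee 6 0"
      using durfee_const[of 6 "2 * t + 1"] by simp
    thus "fps_Sum (\<lambda>m. A t * B (2 * t + 1) m) = A t * durfee 6 0"
      by (simp add: fps_Sum_mult_left B)
  qed
  also have "fps_Sum \<dots> = fps_Sum A * durfee 6 0" by (rule fps_Sum_mult_right[OF A])
  finally have "xi - 1 = 2 * (fps_Sum A * durfee 6 0)" by (simp add: xi_eq_fps_Sum)
  hence "(xi - 1) * qprod (-1) 6 6 = 2 * fps_Sum A * (durfee 6 0 * qprod (-1) 6 6)"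
    by (simp add: mult_ac)
  thus "(xi - 1) * qprod (-1) 6 6 = 2 * fps_Sum A" using durfee_qprod[of 6 0] by simp
qed

section \<open>Trisection\<close>

definition trisect :: "int fps \<Rightarrow> int fps" where
  "trisect f = Abs_fps (\<lambda>n. fps_nth f (3 * n))"

lemma trisect_nth [simp]: "fps_nth (trisect f) n = fps_nth f (3 * n)"
  by (simp add: trisect_def)

lemma trisect_add: "trisect (f + g) = trisect f + trisect g"
  and trisect_diff: "trisect (f - g) = trisect f - trisect g"
  and trisect_minus: "trisect (- f) = - trisect f"
  and trisect_1: "trisect 1 = 1"
  by (simp_all add: fps_eq_iff)

lemma trisect_X_power: "trisect (fps_X ^ e) = (if 3 dvd e then fps_X ^ (e div 3) else 0)"
  by (auto simp: fps_eq_iff)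

lemma trisect_mult_compose: "trisect (f * (g oo fps_X ^ 3)) = trisect f * g"
proof (rule fps_ext)
  fix n
  have "fps_nth (trisect (f * (g oo fps_X ^ 3))) n =
      (\<Sum>i=0..3*n. fps_nth f i * (if 3 dvd 3 * n - i then fps_nth g ((3 * n - i) div 3) else 0))"
    by (simp add: fps_mult_nth fps_nth_compose_X_power)
  also have "\<dots> = (\<Sum>i\<in>(\<lambda>j. 3 * j) ` {0..n}. fps_nth f i *
      (if 3 dvd 3 * n - i then fps_nth g ((3 * n - i) div 3) else 0))"
  proof (rule sum.mono_neutral_right)
    show "\<forall>i\<in>{0..3 * n} - (\<lambda>j. 3 * j) ` {0..n}. fps_nth f i *
      (if 3 dvd 3 * n - i then fps_nth g ((3 * n - i) div 3) else 0) = 0"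
    proof
      fix i assume i: "i \<in> {0..3 * n} - (\<lambda>j. 3 * j) ` {0..n}"
      have "\<not> 3 dvd 3 * n - i"
      proof
        assume "3 dvd 3 * n - i"
        hence "3 dvd i" using i by (auto simp: dvd_diff_nat dest: dvd_diffD1)
        thus False using i by (auto elim!: dvdE)
      qed
      thus "fps_nth f i * (if 3 dvd 3 * n - i then fps_nth g ((3 * n - i) div 3) else 0) = 0" by simp
    qed
  qed auto
  also have "\<dots> = (\<Sum>j=0..n. fps_nth f (3 * j) * fps_nth g (n - j))"
    by (subst sum.reindex) (auto simp: inj_on_def simp flip: right_diff_distrib')
  finally show "fps_nth (trisect (f * (g oo fps_X ^ 3))) n = fps_nth (trisect f * g) n"
    by (simp add: fps_mult_nth)
qed

lemma trisect_Sum: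
  assumes "fps_summable f"
  shows "fps_summable (\<lambda>i. trisect (f i))" "trisect (fps_Sum f) = fps_Sum (\<lambda>i. trisect (f i))"
  using assms by (simp_all add: fps_summable_def fps_Sum_def fps_eq_iff)

lemma geom_compose: "geom (3 * k) = geom k oo fps_X ^ 3"
  by (rule fps_ext) (auto simp: geom_def fps_nth_compose_X_power dvd_div_iff_mult
    dest: dvd_mult_left elim!: dvdE)

text \<open>This moves the denominator into powers of \<open>q^3\<close>, so that trisection acts
  only on a numerator with three terms.\<close>

lemma geom_triple:
  assumes "k > 0"
  shows "geom k = (1 + fps_X ^ k + fps_X ^ (2 * k)) * geom (3 * k)"
proof -
  have "geom k = geom k * ((1 - fps_X ^ (3 * k)) * geom (3 * k))"
    using assms by (simp add: geom_mult)
  also have "1 - fps_X ^ (3 * k) = (1 - fps_X ^ k) * (1 + fps_X ^ k + fps_X ^ (2 * k) :: int fps)"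
    by (simp add: algebra_simps mult_2 flip: power_add)
  also have "geom k * ((1 - fps_X ^ k) * (1 + fps_X ^ k + fps_X ^ (2 * k)) * geom (3 * k)) =
      ((1 - fps_X ^ k) * geom k) * ((1 + fps_X ^ k + fps_X ^ (2 * k)) * geom (3 * k))"
    by (simp only: mult_ac)
  finally show ?thesis using geom_mult[OF assms] by simp
qed

lemma trisect_geom:
  assumes "k > 0"
  shows "trisect (fps_X ^ e * geom k) =
    (trisect (fps_X ^ e) + trisect (fps_X ^ (e + k)) + trisect (fps_X ^ (e + 2 * k))) * geom k"
proof -
  have "fps_X ^ e * geom k = (fps_X ^ e + fps_X ^ (e + k) + fps_X ^ (e + 2 * k)) * (geom k oo fps_X ^ 3)"
    unfolding geom_compose[symmetric]
    by (subst geom_triple[OF assms]) (simp add: algebra_simps power_add)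
  thus ?thesis by (simp add: trisect_mult_compose trisect_add)
qed

text \<open>With \<open>x = q^k\<close> the value is \<open>(1 + x) / (1 - x)\<close>, the factor in
  \<open>U\<close>; this is the origin of the weights 1 and 2.\<close>

lemma geom_Sum:
  assumes "k > 0"
  shows "fps_summable (\<lambda>l. fps_X ^ (k * l) * (if l = 0 then 1 else 2))"
    "fps_Sum (\<lambda>l. fps_X ^ (k * l) * (if l = 0 then 1 else 2)) = 2 * geom k - 1"
proof -
  have le: "l \<le> k * l + 0" for l using assms by simp
  show *: "fps_summable (\<lambda>l. fps_X ^ (k * l) * (if l = 0 then 1 else 2))"
    by (rule fps_summable_nat[OF refl le])
  define g :: "nat \<Rightarrow> int fps" where "g l = fps_X ^ (k * l)" for l
  have g: "fps_summable g" by (rule fps_summable_nat[OF _ le, of _ "\<lambda>_. 1"]) (simp add: g_def)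
  have "fps_Sum g = 1 + fps_Sum (\<lambda>l. fps_X ^ k * g l)"
    by (subst fps_Sum_Suc[OF g]) (simp add: g_def power_add)
  hence "fps_Sum g - fps_X ^ k * fps_Sum g = 1" unfolding fps_Sum_mult_left[OF g] diff_eq_eq .
  hence "(1 - fps_X ^ k) * fps_Sum g = 1" by (simp add: algebra_simps)
  hence "fps_Sum g * ((1 - fps_X ^ k) * geom k) = geom k" by (simp add: mult_ac)
  hence gg: "fps_Sum g = geom k" using geom_mult[OF assms] by simp
  have "fps_Sum (\<lambda>l. fps_X ^ (k * l) * (if l = 0 then 1 else 2)) =
     1 + fps_Sum (\<lambda>l. (2 * fps_X ^ k) * g l)"
    by (subst fps_Sum_Suc[OF *]) (simp add: g_def power_add mult_ac)
  also have "\<dots> = 1 + (2 * fps_X ^ k) * geom k" by (simp only: fps_Sum_mult_left[OF g] gg)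
  also have "\<dots> = 1 + 2 * (fps_X ^ k * geom k)" by simp
  also have "fps_X ^ k * geom k = geom k - 1"
    using geom_mult[OF assms] by (simp add: algebra_simps)
  also have "1 + 2 * (geom k - 1) = 2 * geom k - 1" by simp
  finally show "fps_Sum (\<lambda>l. fps_X ^ (k * l) * (if l = 0 then 1 else 2)) = 2 * geom k - 1" .
qed

lemma qprod_compose: "qprod (-1) 6 6 = qprod (-1) 2 2 oo fps_X ^ 3"
proof (rule fps_eq_if_dvd)
  fix n
  define P :: "int fps" where "P = (\<Prod>i<n. 1 + (-1) * fps_X ^ (2 + 2 * i))"
  have X3: "fps_nth (fps_X ^ 3 :: int fps) 0 = 0" by simp
  have P: "P oo fps_X ^ 3 = (\<Prod>i<n. 1 + (-1) * fps_X ^ (6 + 6 * i))"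
    unfolding P_def fps_compose_prod_distrib[OF X3]
  proof (rule prod.cong[OF refl])
    fix i
    have "fps_X ^ (2 + 2 * i) oo (fps_X ^ 3 :: int fps) = fps_X ^ (3 * (2 + 2 * i))"
      by (simp only: fps_X_power_compose[OF X3] power_mult)
    thus "(1 + (-1) * fps_X ^ (2 + 2 * i)) oo fps_X ^ 3 = (1 + (-1) * fps_X ^ (6 + 6 * i) :: int fps)"
      by (simp add: fps_compose_sub_distrib)
  qed
  obtain h where h: "qprod (-1) 2 2 - P = fps_X ^ n * h"
    using qprod_mod[of 2 n "-1" 2] unfolding P_def by (auto elim: dvdE)
  have "(qprod (-1) 2 2 oo fps_X ^ 3) - (P oo fps_X ^ 3) = (fps_X ^ n * h) oo fps_X ^ 3"
    by (simp flip: h add: fps_compose_sub_distrib)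
  also have "\<dots> = fps_X ^ n * (fps_X ^ (2 * n) * (h oo fps_X ^ 3))"
  proof -
    have "(fps_X ^ 3) ^ n = fps_X ^ n * (fps_X ^ (2 * n) :: int fps)"
      unfolding power_mult[symmetric] power_add[symmetric] by simp
    thus ?thesis
      by (simp only: fps_compose_mult_distrib[OF X3] fps_X_power_compose[OF X3] mult.assoc)
  qed
  finally have "fps_X ^ n dvd (qprod (-1) 2 2 oo fps_X ^ 3) - (P oo fps_X ^ 3)" by simp
  from dvd_diff[OF qprod_mod[of 6 n "-1" 6] this]
  show "fps_X ^ n dvd qprod (-1) 6 6 - (qprod (-1) 2 2 oo fps_X ^ 3)"
    by (simp add: P)
qed

text \<open>
  Expanding the geometric series in the trisected Appell--Lerch sum and collecting along
  \<open>t + l = k\<close> leaves a finite sum in \<open>p = q\<^sup>3\<close>, which obeys a first-order recurrence in \<open>k\<close>.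
\<close>

definition indef_theta :: "nat \<Rightarrow> int fps" where
  "indef_theta k = (\<Sum>t\<le>k. (-1) ^ t * fps_X ^ (3 * (t * t + 2 * t * (k - t))) * (if k - t = 0 then 1 else 2))"

text \<open>The numerator exponents have residues 1, 2, 0 modulo 3 for the first geometric series
  and 0, 2, 1 for the second, so exactly one of the three survives in each.\<close>

lemma trisect_appell_term:
  "trisect (fps_X ^ (9 * t ^ 2 + 9 * t + 1) * ((-1) ^ t * lambert_factor t)) =
    (-1) ^ t * (fps_X ^ (3 * t ^ 2 + 7 * t + 1) * geom (6 * t + 1) +
                fps_X ^ (3 * t ^ 2 + 5 * t + 2) * geom (6 * t + 5))"
proof -
  define e where "e = 9 * t ^ 2 + 9 * t + 1"
  define s where "s = 3 * t ^ 2 + 3 * t"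
  have e: "e = 3 * s + 1" by (simp add: e_def s_def)
  have sign: "trisect ((-1) ^ t * f) = (-1) ^ t * trisect f" for f
    by (cases "even t") (simp_all add: trisect_minus)
  have 1: "trisect (fps_X ^ e * geom (6 * t + 1)) = fps_X ^ (3 * t ^ 2 + 7 * t + 1) * geom (6 * t + 1)"
  proof -
    have "\<not> 3 dvd e" "\<not> 3 dvd e + (6 * t + 1)" unfolding e by presburger+
    hence "trisect (fps_X ^ e) = 0" "trisect (fps_X ^ (e + (6 * t + 1))) = 0"
      by (simp_all only: trisect_X_power if_False)
    moreover have e3: "e + 2 * (6 * t + 1) = 3 * (3 * t ^ 2 + 7 * t + 1)" by (simp add: e_def)
    have "trisect (fps_X ^ (e + 2 * (6 * t + 1))) = fps_X ^ (3 * t ^ 2 + 7 * t + 1)"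
      unfolding e3 by (simp add: trisect_X_power)
    ultimately show ?thesis using trisect_geom[of "6 * t + 1" e] by simp
  qed
  have 2: "trisect (fps_X ^ (e + (6 * t + 5)) * geom (6 * t + 5)) = fps_X ^ (3 * t ^ 2 + 5 * t + 2) * geom (6 * t + 5)"
  proof -
    have "\<not> 3 dvd e + (6 * t + 5) + (6 * t + 5)" "\<not> 3 dvd e + (6 * t + 5) + 2 * (6 * t + 5)"
      unfolding e by presburger+
    hence "trisect (fps_X ^ (e + (6 * t + 5) + (6 * t + 5))) = 0"
      "trisect (fps_X ^ (e + (6 * t + 5) + 2 * (6 * t + 5))) = 0"
      by (simp_all only: trisect_X_power if_False)
    moreover have e3: "e + (6 * t + 5) = 3 * (3 * t ^ 2 + 5 * t + 2)" by (simp add: e_def)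
    have "trisect (fps_X ^ (e + (6 * t + 5))) = fps_X ^ (3 * t ^ 2 + 5 * t + 2)"
      unfolding e3 by (simp add: trisect_X_power)
    ultimately show ?thesis
      using trisect_geom[of "6 * t + 5" "e + (6 * t + 5)"] by (simp only: add_0_right zero_less_Suc)
  qed
  have "fps_X ^ e * ((-1) ^ t * lambert_factor t) =
     (-1) ^ t * (fps_X ^ e * geom (6 * t + 1) + fps_X ^ (e + (6 * t + 5)) * geom (6 * t + 5))"
    unfolding lambert_factor_eq power_add[of _ e] by (simp only: ring_distribs mult_ac)
  thus ?thesis unfolding e_def[symmetric] by (simp only: sign trisect_add 1 2)
qed

text \<open>The constant term 1 of \<open>xi\<close> contributes \<open>qprod (-1) 2 2\<close>. Its
  pentagonal expansion \<open>e1 - e2\<close> is just what completes each geometric series to the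
  form \<open>(1 + x) / (1 - x)\<close>.\<close>

theorem trisect_xi:
  "fps_summable (\<lambda>n. (fps_X ^ n + fps_X ^ (5 * n + 2)) * indef_theta n)"
  "trisect xi * qprod (-1) 2 2 = fps_Sum (\<lambda>n. (fps_X ^ n + fps_X ^ (5 * n + 2)) * indef_theta n)"
proof -
  define c :: "nat \<Rightarrow> int fps" where "c l = (if l = 0 then 1 else 2)" for l
  show "fps_summable (\<lambda>n. (fps_X ^ n + fps_X ^ (5 * n + 2)) * indef_theta n)"
  proof (rule fps_summable_nat)
    have "fps_X ^ (5 * n + 2) = fps_X ^ n * (fps_X ^ (4 * n + 2) :: int fps)" for n
      unfolding power_add[symmetric] by (rule arg_cong[of _ _ "\<lambda>n. fps_X ^ n"]) simp
    thus "(fps_X ^ n + fps_X ^ (5 * n + 2)) * indef_theta n =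
       fps_X ^ n * ((1 + fps_X ^ (4 * n + 2)) * indef_theta n)" for n
      by (simp only: ring_distribs mult_ac mult_1_left)
    show "n \<le> n + 0" for n :: nat by simp
  qed
  define A where "A t = fps_X ^ (9 * t ^ 2 + 9 * t + 1) * ((-1) ^ t * lambert_factor t)" for t
  define e1 e2 :: "nat \<Rightarrow> int fps" where
    "e1 t = fps_X ^ (3 * t ^ 2 + t) * (-1) ^ t" and "e2 t = fps_X ^ (3 * t ^ 2 + 5 * t + 2) * (-1) ^ t" for t
  define g1 g2 where "g1 t l = fps_X ^ ((6 * t + 1) * l) * c l" and
     "g2 t l = fps_X ^ ((6 * t + 5) * l) * c l" for t l :: nat
  have A: "fps_summable A" "(xi - 1) * qprod (-1) 6 6 = 2 * fps_Sum A"
    unfolding A_def[abs_def] by (rule xi_appell_lerch)+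
  have sA: "fps_summable (\<lambda>t. trisect (A t))" by (rule trisect_Sum(1)[OF A(1)])
  have se: "fps_summable e1" "fps_summable e2"
  proof -
    show "fps_summable e1"
    proof (rule fps_summable_nat)
      show "e1 t = fps_X ^ (3 * t ^ 2 + t) * (-1) ^ t" for t by (rule e1_def)
    qed simp
    show "fps_summable e2"
    proof (rule fps_summable_nat)
      show "e2 t = fps_X ^ (3 * t ^ 2 + 5 * t + 2) * (-1) ^ t" for t by (rule e2_def)
      show "t \<le> 3 * t ^ 2 + 5 * t + 2 + 0" for t :: nat by simp
    qed
  qed
  have sg: "fps_summable (g1 t)" "fps_summable (g2 t)"
    and g: "fps_Sum (g1 t) = 2 * geom (6 * t + 1) - 1" "fps_Sum (g2 t) = 2 * geom (6 * t + 5) - 1" for t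
    using geom_Sum[of "6 * t + 1"] geom_Sum[of "6 * t + 5"]
    unfolding g1_def[abs_def] g2_def[abs_def] c_def by simp_all
  have "(trisect xi - 1) * qprod (-1) 2 2 = trisect ((xi - 1) * qprod (-1) 6 6)"
    unfolding qprod_compose by (simp add: trisect_mult_compose trisect_diff trisect_1)
  also have "\<dots> = 2 * fps_Sum (\<lambda>t. trisect (A t))"
    unfolding A(2) by (simp only: mult_2 trisect_add trisect_Sum(2)[OF A(1)])
  finally have 1: "trisect xi * qprod (-1) 2 2 = qprod (-1) 2 2 + fps_Sum (\<lambda>t. 2 * trisect (A t))"
    unfolding fps_Sum_mult_left[OF sA] by (simp add: algebra_simps)
  \<comment> \<open>Euler's pentagonal series in \<open>q^2\<close>: sorted modulo 6, the factors of
    \<open>(q^2; q^2)\<close> form a triple product in base \<open>q^6\<close>.\<close>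
  have th: "fps_summable (theta_term (-1) 4 6)"
    "fps_Sum (theta_term (-1) 4 6) = qprod (-1) 4 6 * qprod (-1) 2 6 * qprod (-1) 6 6"
    using jacobi_triple_product[of 6 4 "-1"] by simp_all
  have "qprod (-1) 2 2 = fps_Sum (theta_term (-1) 4 6)"
    unfolding th(2) using qprod_split3[of 2 "-1" 2] by (simp add: mult_ac)
  also have "\<dots> = fps_Sum (\<lambda>t. theta_term (-1) 4 6 (int t)) + fps_Sum (\<lambda>t. theta_term (-1) 4 6 (- 1 - int t))"
    by (rule fps_Sum_int[OF th(1)])
  also have "(\<lambda>t. theta_term (-1) 4 6 (int t)) = e1"
  proof
    fix t
    have "4 * t + 6 * (t choose 2) = 3 * t ^ 2 + t"
      using double_choose_two[of t] by (simp add: power2_eq_square)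
    thus "theta_term (-1) 4 6 (int t) = e1 t" unfolding theta_term_nonneg e1_def by simp
  qed
  also have "(\<lambda>t. theta_term (-1) 4 6 (- 1 - int t)) = (\<lambda>t. - e2 t)"
  proof
    fix t
    have "(6 - 4) * Suc t + 6 * (Suc t choose 2) = 3 * t ^ 2 + 5 * t + 2"
      using double_choose_two[of t] by (simp add: power2_eq_square Suc_choose_two)
    moreover have "- 1 - int t = - int (Suc t)" by simp
    moreover have "(4 :: nat) \<le> 6" by simp
    ultimately show "theta_term (-1) 4 6 (- 1 - int t) = - e2 t"
      using theta_term_nonpos[of 4 6 "-1" "Suc t"] unfolding e2_def by (metis mult_minus_right mult_minus1 power_Suc)
  qed
  also have "fps_Sum (\<lambda>t. - e2 t) = - fps_Sum e2" by (rule fps_Sum_minus)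
  finally have "trisect xi * qprod (-1) 2 2 = fps_Sum (\<lambda>t. e1 t - e2 t + 2 * trisect (A t))"
    unfolding 1 using se sA
    by (simp add: fps_Sum_add fps_Sum_diff fps_summable_diff fps_summable_mult_left)
  also have "(\<lambda>t. e1 t - e2 t + 2 * trisect (A t)) = (\<lambda>t. fps_Sum (\<lambda>l. e1 t * g1 t l + e2 t * g2 t l))"
  proof
    fix t
    have k: "fps_X ^ (6 * t + 1) * geom (6 * t + 1) = geom (6 * t + 1) - 1"
      using geom_mult[of "6 * t + 1"] by (simp add: algebra_simps)
    have "3 * t ^ 2 + 7 * t + 1 = 3 * t ^ 2 + t + (6 * t + 1)" by simp
    hence "e1 t - e2 t + 2 * trisect (A t) =
      e1 t * (1 + 2 * (fps_X ^ (6 * t + 1) * geom (6 * t + 1))) + e2 t * (2 * geom (6 * t + 5) - 1)"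
      unfolding A_def trisect_appell_term e1_def e2_def
      by (simp only: power_add) (simp add: algebra_simps)
    also have "1 + 2 * (fps_X ^ (6 * t + 1) * geom (6 * t + 1)) = 2 * geom (6 * t + 1) - 1"
      unfolding k by simp
    also have "e1 t * (2 * geom (6 * t + 1) - 1) + e2 t * (2 * geom (6 * t + 5) - 1) =
      fps_Sum (\<lambda>l. e1 t * g1 t l + e2 t * g2 t l)"
      unfolding fps_Sum_add[OF fps_summable_mult_left[OF sg(1)] fps_summable_mult_left[OF sg(2)]]
        fps_Sum_mult_left[OF sg(1)] fps_Sum_mult_left[OF sg(2)] g ..
    finally show "e1 t - e2 t + 2 * trisect (A t) = fps_Sum (\<lambda>l. e1 t * g1 t l + e2 t * g2 t l)" .
  qed
  also have "fps_Sum \<dots> = fps_Sum (\<lambda>n. \<Sum>t\<le>n. e1 t * g1 t (n - t) + e2 t * g2 t (n - t))"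
  proof (rule fps_Sum_triangle[symmetric])
    show "fps_summable (\<lambda>(t, l). e1 t * g1 t l + e2 t * g2 t l)"
      using fps_summable_add[OF fps_summable_mult_Pair[OF se(1) sg(1)] fps_summable_mult_Pair[OF se(2) sg(2)]]
      by (simp add: case_prod_unfold)
  qed
  also have "(\<lambda>n. \<Sum>t\<le>n. e1 t * g1 t (n - t) + e2 t * g2 t (n - t)) =
     (\<lambda>n. (fps_X ^ n + fps_X ^ (5 * n + 2)) * indef_theta n)"
  proof
    fix n
    show "(\<Sum>t\<le>n. e1 t * g1 t (n - t) + e2 t * g2 t (n - t)) =
       (fps_X ^ n + fps_X ^ (5 * n + 2)) * indef_theta n"
      unfolding indef_theta_def sum_distrib_left
    proof (rule sum.cong[OF refl])
      fix t assume "t \<in> {..n}"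
      then obtain l where n: "n = t + l" by (auto simp: le_iff_add)
      \<comment> \<open>Both exponents share the part \<open>3 (t^2 + 2 t l)\<close>, and what
        remains depends only on \<open>n = t + l\<close>; hence the common factor
        \<open>indef_theta n\<close>.\<close>
      have "3 * t ^ 2 + t + (6 * t + 1) * l = n + 3 * (t * t + 2 * t * l)"
        "3 * t ^ 2 + 5 * t + 2 + (6 * t + 5) * l = 5 * n + 2 + 3 * (t * t + 2 * t * l)"
        by (simp_all add: n algebra_simps power2_eq_square)
      hence e: "fps_X ^ (3 * t ^ 2 + t) * fps_X ^ ((6 * t + 1) * l) =
          fps_X ^ n * (fps_X ^ (3 * (t * t + 2 * t * l)) :: int fps)"
        "fps_X ^ (3 * t ^ 2 + 5 * t + 2) * fps_X ^ ((6 * t + 5) * l) =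
          fps_X ^ (5 * n + 2) * (fps_X ^ (3 * (t * t + 2 * t * l)) :: int fps)"
        unfolding power_add[symmetric] by metis+
      have "e1 t * g1 t l + e2 t * g2 t l =
         (fps_X ^ (3 * t ^ 2 + t) * fps_X ^ ((6 * t + 1) * l) +
          fps_X ^ (3 * t ^ 2 + 5 * t + 2) * fps_X ^ ((6 * t + 5) * l)) * ((-1) ^ t * c l)"
        unfolding e1_def e2_def g1_def g2_def by (simp only: ring_distribs mult_ac)
      also have "\<dots> = (fps_X ^ n + fps_X ^ (5 * n + 2)) *
          ((-1) ^ t * fps_X ^ (3 * (t * t + 2 * t * l)) * c l)"
        unfolding e by (simp only: ring_distribs mult_ac)
      finally show "e1 t * g1 t (n - t) + e2 t * g2 t (n - t) = (fps_X ^ n + fps_X ^ (5 * n + 2)) *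
          ((-1) ^ t * fps_X ^ (3 * (t * t + 2 * t * (n - t))) * (if n - t = 0 then 1 else 2))"
        by (simp add: n c_def)
    qed
  qed
  finally show "trisect xi * qprod (-1) 2 2 =
     fps_Sum (\<lambda>n. (fps_X ^ n + fps_X ^ (5 * n + 2)) * indef_theta n)" .
qed

lemma indef_theta_0: "indef_theta 0 = 1"
  by (simp add: indef_theta_def)

text \<open>The term \<open>t = 0\<close> is 2. In the others \<open>t\<close> is lowered by one,
  and \<open>(t+1)^2 + 2 (t+1) l = (2 k + 1) + t^2 + 2 t l\<close> for
  \<open>k = t + l\<close>.\<close>

lemma indef_theta_Suc: "indef_theta (Suc k) = 2 - fps_X ^ (3 * (2 * k + 1)) * indef_theta k"
proof -
  have "indef_theta (Suc k) = 2 + (\<Sum>t\<le>k. (-1) ^ Suc t *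
     fps_X ^ (3 * (Suc t * Suc t + 2 * Suc t * (k - t))) * (if k - t = 0 then 1 else 2))"
  proof -
    have "(-1) ^ 0 * fps_X ^ (3 * (0 * 0 + 2 * 0 * (Suc k - 0))) * (if Suc k - 0 = 0 then 1 else 2) = (2 :: int fps)"
      by simp
    thus ?thesis unfolding indef_theta_def sum.atMost_Suc_shift diff_Suc_Suc by (simp only:)
  qed
  also have "(\<Sum>t\<le>k. (-1) ^ Suc t *
     fps_X ^ (3 * (Suc t * Suc t + 2 * Suc t * (k - t))) * (if k - t = 0 then 1 else 2)) =
     (- (fps_X ^ (3 * (2 * k + 1)))) * indef_theta k"
    unfolding indef_theta_def sum_distrib_left
  proof (rule sum.cong[OF refl])
    fix t assume "t \<in> {..k}"
    then obtain l where k: "k = t + l" by (auto simp: le_iff_add)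
    have "3 * (Suc t * Suc t + 2 * Suc t * l) = 3 * (2 * k + 1) + 3 * (t * t + 2 * t * l)"
      by (simp add: k algebra_simps)
    hence e: "fps_X ^ (3 * (Suc t * Suc t + 2 * Suc t * (k - t))) =
      fps_X ^ (3 * (2 * k + 1)) * (fps_X ^ (3 * (t * t + 2 * t * (k - t))) :: int fps)"
      unfolding power_add[symmetric] by (simp add: k)
    show "(-1) ^ Suc t *
     fps_X ^ (3 * (Suc t * Suc t + 2 * Suc t * (k - t))) * (if k - t = 0 then 1 else 2) =
     (- (fps_X ^ (3 * (2 * k + 1)))) * ((-1) ^ t * fps_X ^ (3 * (t * t + 2 * t * (k - t))) *
       (if k - t = 0 then 1 else 2) :: int fps)"
      unfolding e power_Suc by (simp only: mult_minus_left mult_minus_right mult_1_left mult_ac)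
  qed
  finally show ?thesis by simp
qed

section \<open>The functional equation\<close>

text \<open>Negative exponents collapse to 1, so products may be combined only when both exponents
  are nonnegative.\<close>

definition qexp :: "int \<Rightarrow> int fps" where
  "qexp x = fps_X ^ nat x"

lemma qexp_mult: "x \<ge> 0 \<Longrightarrow> y \<ge> 0 \<Longrightarrow> qexp x * qexp y = qexp (x + y)"
  by (simp add: qexp_def nat_add_distrib flip: power_add)

lemma qexp_0 [simp]: "qexp 0 = 1"
  by (simp add: qexp_def)

lemma qexp_neq_0 [simp]: "qexp x \<noteq> 0"
  by (simp add: qexp_def)

lemma qexp_int: "qexp (int n) = fps_X ^ n"
  by (simp add: qexp_def)

definition parity_sign :: "int \<Rightarrow> int fps" where
  "parity_sign i = (if even i then 1 else -1)"

definition tri :: "int \<Rightarrow> int" where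
  "tri i = i * (i - 1) div 2"

lemma double_tri: "2 * tri i = i * (i - 1)"
  by (simp add: tri_def)

lemma tri_nonneg [simp]: "tri i \<ge> 0"
proof -
  have "i * (i - 1) \<ge> 0"
    by (cases "i \<ge> 1") (auto simp: zero_le_mult_iff)
  thus ?thesis using double_tri[of i] by linarith
qed

lemma tri_add_1: "tri (i + 1) = tri i + i"
  using double_tri[of i] double_tri[of "i + 1"] by (simp add: algebra_simps)

lemma tri_reflect: "tri (1 - i) = tri i"
  using double_tri[of i] double_tri[of "1 - i"] by (simp add: algebra_simps)

lemma theta_term_neg1: "theta_term (-1) a b i = qexp (int a * i + int b * tri i) * parity_sign i"
proof -
  have "(-1) ^ nat \<bar>i\<bar> = parity_sign i"
    by (auto simp: parity_sign_def minus_one_power_iff even_nat_iff)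
  thus ?thesis by (simp add: theta_term_def qexp_def tri_def)
qed

lemma theta_term_1: "theta_term 1 a b i = qexp (int a * i + int b * tri i)"
  by (simp add: theta_term_def qexp_def tri_def)

text \<open>
  With \<open>p = q\<^sup>3\<close>, \<open>indef_coeff k\<close> is the coefficient of \<open>w\<^sup>k\<close>, expanded in \<open>\<bar>p\<^sup>2\<bar> < \<bar>w\<bar> < 1\<close>, of
  \<open>U(w) = \<Sum>\<^sub>r (-1)\<^sup>r p\<^bsup>r\<^sup>2\<^esup> w\<^sup>r (1 + w p\<^bsup>2r\<^esup>) / (1 - w p\<^bsup>2r\<^esup>)\<close>, and \<open>conv_coeff k\<close> is the coefficient of
  \<open>w\<^sup>k\<close> in the product of \<open>U(w)\<close> with the theta series \<open>j(w; p\<^sup>2)\<close>, which removes the poles.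
\<close>

definition indef_coeff :: "int \<Rightarrow> int fps" where
  "indef_coeff k = (if k \<ge> 0 then indef_theta (nat k)
     else qexp (3 * (- 2 * k - 1)) * indef_theta (nat (- k - 1)))"

text \<open>This is \<open>U(1/w) = - U(w)\<close> for coefficients. Inversion leads to the annulus
  on the other side of the pole \<open>w = 1\<close>, and crossing that pole changes every
  coefficient by 2.\<close>

lemma indef_coeff_reflect: "indef_coeff (- k) = 2 - indef_coeff k"
proof -
  have pos: "indef_coeff (- k) = 2 - indef_coeff k" if "k > 0" for k
  proof -
    define n where "n = nat (k - 1)"
    have k: "k = int (Suc n)" using that by (simp add: n_def)
    have q: "qexp (3 * (- 2 * - k - 1)) = fps_X ^ (3 * (2 * n + 1))"
      unfolding qexp_int[symmetric] by (rule arg_cong[of _ _ qexp]) (simp add: k)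
    have "nat k = Suc n" "nat (- (- k) - 1) = n" using k by simp_all
    moreover have "\<not> - k \<ge> 0" "k \<ge> 0" using that by simp_all
    ultimately have "indef_coeff (- k) = fps_X ^ (3 * (2 * n + 1)) * indef_theta n"
      "indef_coeff k = indef_theta (Suc n)"
      unfolding indef_coeff_def by (simp_all only: if_True if_False q)
    thus ?thesis unfolding indef_theta_Suc by (simp only: diff_diff_eq2 add_diff_cancel_left')
  qed
  consider "k > 0" | "k = 0" | "k < 0" by linarith
  thus ?thesis
  proof cases
    case 2
    thus ?thesis by (simp add: indef_coeff_def indef_theta_0)
  next
    case 3
    hence "indef_coeff k = 2 - indef_coeff (- k)" using pos[of "- k"] by simp
    thus ?thesis by (simp only: diff_diff_eq2 add_diff_cancel_left')
  qed (rule pos)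
qed

lemma indef_coeff_add_1:
  assumes "k \<ge> 0"
  shows "indef_coeff (k + 1) = 2 - qexp (3 * (2 * k + 1)) * indef_coeff k"
proof -
  obtain n where k: "k = int n" using assms by (rule nonneg_int_cases)
  have q: "qexp (3 * (2 * k + 1)) = fps_X ^ (3 * (2 * n + 1))"
    unfolding qexp_int[symmetric] by (rule arg_cong[of _ _ qexp]) (simp add: k)
  have "nat (k + 1) = Suc n" "nat k = n" "k + 1 \<ge> 0" using k by simp_all
  hence "indef_coeff (k + 1) = indef_theta (Suc n)" "indef_coeff k = indef_theta n"
    using assms unfolding indef_coeff_def by (simp_all only: if_True)
  thus ?thesis unfolding q by (simp only: indef_theta_Suc)
qed

section \<open>The product of U with the theta series vanishing at its poles\<close>

definition alt_theta :: "int \<Rightarrow> int fps" where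
  "alt_theta = theta_term (-1) 0 6"

lemma alt_theta_eq: "alt_theta i = qexp (6 * tri i) * parity_sign i"
  by (simp add: alt_theta_def theta_term_neg1)

lemma summable_alt_theta: "fps_summable alt_theta"
  and Sum_alt_theta: "fps_Sum alt_theta = 0"
proof -
  show "fps_summable alt_theta" unfolding alt_theta_def by (rule jacobi_triple_product) auto
  have "fps_Sum alt_theta = qprod (-1) 0 6 * qprod (-1) 6 6 * qprod (-1) 6 6"
    unfolding alt_theta_def using jacobi_triple_product(2)[of 6 0 "-1"] by simp
  also have "qprod (-1) 0 6 = 0" by (subst qprod_rec) simp_all
  finally show "fps_Sum alt_theta = 0" by simp
qed

lemma alt_theta_reflect: "alt_theta (1 - i) = - alt_theta i"
  by (simp add: alt_theta_eq tri_reflect parity_sign_def)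

definition conv_coeff :: "int \<Rightarrow> int fps" where
  "conv_coeff k = fps_Sum (\<lambda>i. alt_theta i * indef_coeff (k - i))"

lemma summable_alt_theta_mult: "fps_summable (\<lambda>i. alt_theta i * g i)"
proof (rule fps_summable_int)
  show "alt_theta i * g i = fps_X ^ nat (6 * tri i) * (parity_sign i * g i)" for i
    by (simp add: alt_theta_eq qexp_def mult.assoc)
  show "\<bar>i\<bar> \<le> int (nat (6 * tri i)) + 1" for i
  proof -
    have "\<bar>i\<bar> - 1 \<le> 3 * (i * (i - 1))"
    proof (cases "i \<ge> 2")
      case True
      hence "i * 1 \<le> i * (i - 1)" by (intro mult_left_mono) auto
      thus ?thesis using True by simp
    next
      case False
      show ?thesis
      proof (cases "i \<ge> 0")
        case True
        with False have "i = 0 \<or> i = 1" by linarith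
        thus ?thesis by auto
      next
        case False
        hence "(- i) * 1 \<le> (- i) * (1 - i)" by (intro mult_left_mono) auto
        hence "- i \<le> i * (i - 1)" by (simp add: algebra_simps)
        thus ?thesis using False by simp
      qed
    qed
    thus ?thesis using double_tri[of i] tri_nonneg[of i] by simp
  qed
qed

text \<open>The signs from both reflections cancel, and the constant 2 is annihilated because
  \<open>alt_theta\<close> sums to 0: the product has no pole at \<open>w = 1\<close>.\<close>

lemma conv_coeff_reflect: "conv_coeff (1 - k) = conv_coeff k"
proof -
  have "bij (\<lambda>i :: int. 1 - i)" by (rule o_bij[of "\<lambda>i. 1 - i"]) auto
  from fps_Sum_reindex_bij[OF this, of "\<lambda>i. alt_theta i * indef_coeff (1 - k - i)"]
  have "conv_coeff (1 - k) = fps_Sum (\<lambda>i. alt_theta (1 - i) * indef_coeff (- (k - i)))"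
    by (simp add: conv_coeff_def algebra_simps)
  also have "\<dots> = fps_Sum (\<lambda>i. alt_theta i * indef_coeff (k - i) - alt_theta i * 2)"
    unfolding alt_theta_reflect indef_coeff_reflect by (simp add: algebra_simps)
  also have "\<dots> = conv_coeff k - fps_Sum (\<lambda>i. alt_theta i * 2)"
    unfolding conv_coeff_def by (intro fps_Sum_diff summable_alt_theta_mult)
  also have "fps_Sum (\<lambda>i. alt_theta i * 2) = 0"
    by (simp add: fps_Sum_mult_right summable_alt_theta Sum_alt_theta)
  finally show ?thesis by simp
qed

text \<open>Under \<open>w -> p^2 w\<close> the theta series gains \<open>- 1/w\<close> and
  \<open>U\<close> gains \<open>- 1/(p w)\<close>. The product gains \<open>1/(p w^2)\<close>, which
  relates coefficients at distance 2.\<close>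

lemma conv_coeff_add_2:
  assumes k: "k \<ge> 0"
  shows "conv_coeff (k + 2) = qexp (3 * (2 * k + 1)) * conv_coeff k"
proof -
  have termwise: "alt_theta (i + 1) * indef_coeff (k - i + 1) =
      alt_theta (i + 1) * 2 + qexp (3 * (2 * k + 1)) * (alt_theta i * indef_coeff (k - i))" for i
  proof -
    have sgn: "parity_sign (i + 1) = - parity_sign i" by (simp add: parity_sign_def)
    show ?thesis
    proof (cases "k - i \<ge> 0")
      case True
      have "qexp (6 * tri (i + 1) + 3 * (2 * (k - i) + 1)) = qexp (3 * (2 * k + 1) + 6 * tri i)"
        by (rule arg_cong[of _ _ qexp]) (simp add: tri_add_1)
      hence e: "qexp (6 * tri (i + 1)) * qexp (3 * (2 * (k - i) + 1)) = qexp (3 * (2 * k + 1)) * qexp (6 * tri i)"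
        using True k by (subst (1 2) qexp_mult) simp_all
      have "qexp (6 * tri (i + 1)) * parity_sign i * (qexp (3 * (2 * (k - i) + 1)) * indef_coeff (k - i)) =
        (qexp (6 * tri (i + 1)) * qexp (3 * (2 * (k - i) + 1))) * (parity_sign i * indef_coeff (k - i))"
        by (simp only: mult_ac)
      also have "\<dots> = qexp (3 * (2 * k + 1)) * (qexp (6 * tri i) * parity_sign i * indef_coeff (k - i))"
        unfolding e by (simp only: mult_ac)
      finally show ?thesis
        unfolding indef_coeff_add_1[OF True] alt_theta_eq sgn right_diff_distrib
        by (simp only: mult_minus_left mult_minus_right minus_diff_eq diff_minus_eq_add)
    next
      case False
      \<comment> \<open>For \<open>i > k\<close> the recurrence of \<open>indef_coeff\<close> would
        need a negative exponent; reflection to \<open>m \<ge> 0\<close> keeps all exponents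
        nonnegative.\<close>
      define m where "m = i - k - 1"
      have m: "m \<ge> 0" "k - i + 1 = - m" "k - i = - m - 1" using False by (simp_all add: m_def)
      have "3 * (2 * k + 1) + 6 * tri i + 3 * (2 * m + 1) = 6 * tri (i + 1)"
        by (simp add: tri_add_1 m_def)
      hence e: "qexp (3 * (2 * k + 1)) * qexp (6 * tri i) * qexp (3 * (2 * m + 1)) = qexp (6 * tri (i + 1))"
        using m(1) k by (simp add: qexp_mult)
      have r: "indef_coeff (- m - 1) = qexp (3 * (2 * m + 1)) * indef_coeff m"
        using m(1) by (simp add: indef_coeff_def algebra_simps)
      have "qexp (3 * (2 * k + 1)) * (alt_theta i * indef_coeff (k - i)) =
         qexp (6 * tri (i + 1)) * parity_sign i * indef_coeff m"
        unfolding alt_theta_eq m(3) r e[symmetric] by (simp only: mult_ac)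
      thus ?thesis
        unfolding m(2) indef_coeff_reflect alt_theta_eq[of "i + 1"] sgn right_diff_distrib
        by (simp only: mult_minus_left mult_minus_right diff_minus_eq_add)
    qed
  qed
  have "bij (\<lambda>i :: int. i + 1)" by (rule o_bij[of "\<lambda>i. i - 1"]) auto
  note shift = fps_Sum_reindex_bij[OF this]
  have "conv_coeff (k + 2) = fps_Sum (\<lambda>i. alt_theta (i + 1) * indef_coeff (k - i + 1))"
    using shift[of "\<lambda>i. alt_theta i * indef_coeff (k + 2 - i)"]
    by (simp add: conv_coeff_def algebra_simps)
  also have "\<dots> = fps_Sum (\<lambda>i. alt_theta (i + 1) * 2) +
      fps_Sum (\<lambda>i. qexp (3 * (2 * k + 1)) * (alt_theta i * indef_coeff (k - i)))"
    unfolding termwise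
  proof (rule fps_Sum_add)
    show "fps_summable (\<lambda>i. alt_theta (i + 1) * 2)"
      by (rule fps_summable_reindex[of "\<lambda>i. i + 1" "\<lambda>i. alt_theta i * 2"])
        (auto intro: summable_alt_theta_mult)
    show "fps_summable (\<lambda>i. qexp (3 * (2 * k + 1)) * (alt_theta i * indef_coeff (k - i)))"
      by (intro fps_summable_mult_left summable_alt_theta_mult)
  qed
  also have "fps_Sum (\<lambda>i. alt_theta (i + 1) * 2) = 0"
    using shift[of "\<lambda>i. alt_theta i * 2"]
    by (simp add: fps_Sum_mult_right summable_alt_theta Sum_alt_theta)
  also have "fps_Sum (\<lambda>i. qexp (3 * (2 * k + 1)) * (alt_theta i * indef_coeff (k - i))) =
      qexp (3 * (2 * k + 1)) * conv_coeff k"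
    unfolding conv_coeff_def by (intro fps_Sum_mult_left summable_alt_theta_mult)
  finally show ?thesis by simp
qed

text \<open>The recurrence treats even and odd indices separately. Reflection supplies
  \<open>conv_coeff 1 = conv_coeff 0\<close> and all negative indices, so the product is a multiple
  of the theta series with coefficients \<open>p^(k(k-1)/2)\<close>.\<close>

lemma conv_coeff_eq: "conv_coeff k = qexp (3 * tri k) * conv_coeff 0"
proof -
  have nat: "conv_coeff (int n) = qexp (3 * tri (int n)) * conv_coeff 0" for n
  proof (induction n rule: induct_nat_012)
    case 1
    show ?case using conv_coeff_reflect[of 0] by (simp add: tri_def)
  next
    case (ge2 n)
    have e: "int (Suc (Suc n)) = int n + 2" by simp
    have "tri (int n + 1 + 1) = tri (int n) + (2 * int n + 1)"
      unfolding tri_add_1 by simp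
    hence "tri (int n + 2) = tri (int n) + (2 * int n + 1)" by (simp add: add.assoc)
    hence "qexp (3 * tri (int n + 2)) = qexp (3 * (2 * int n + 1)) * qexp (3 * tri (int n))"
      by (subst qexp_mult) (simp_all add: algebra_simps)
    thus ?case
      unfolding e using conv_coeff_add_2[of "int n"] ge2.IH(1) by simp
  qed (simp add: tri_def)
  show ?thesis
  proof (cases "k \<ge> 0")
    case True
    thus ?thesis using nat[of "nat k"] by simp
  next
    case False
    thus ?thesis using nat[of "nat (1 - k)"] by (simp add: conv_coeff_reflect tri_reflect)
  qed
qed

text \<open>The term \<open>indef_coeff k * w\<^sup>k\<close> at \<open>w = q\<close>, where the exponent is never negative.\<close>

definition indef_term :: "int \<Rightarrow> int fps" where
  "indef_term k = (if k \<ge> 0 then fps_X ^ nat k * indef_theta (nat k)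
     else fps_X ^ nat (- 5 * k - 3) * indef_theta (nat (- k - 1)))"

lemma summable_indef_term: "fps_summable indef_term"
proof (rule fps_summable_int)
  show "indef_term k = fps_X ^ nat (if k \<ge> 0 then k else - 5 * k - 3) *
      indef_theta (nat (if k \<ge> 0 then k else - k - 1))" for k
    by (simp add: indef_term_def)
  show "\<bar>k\<bar> \<le> int (nat (if k \<ge> 0 then k else - 5 * k - 3)) + 0" for k
    by auto
qed

lemma Sum_indef_term:
  "fps_Sum indef_term = fps_Sum (\<lambda>n. (fps_X ^ n + fps_X ^ (5 * n + 2)) * indef_theta n)"
proof -
  have 1: "indef_term (int n) = fps_X ^ n * indef_theta n" for n
    by (simp add: indef_term_def)
  have 2: "indef_term (- 1 - int n) = fps_X ^ (5 * n + 2) * indef_theta n" for n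
  proof -
    have "nat (- 5 * (- 1 - int n) - 3) = 5 * n + 2" "nat (- (- 1 - int n) - 1) = n" by simp_all
    thus ?thesis unfolding indef_term_def by simp
  qed
  have "fps_summable (\<lambda>n. fps_X ^ n * indef_theta n)"
    by (rule fps_summable_nat[OF refl, of _ 0]) simp
  moreover have "fps_summable (\<lambda>n. fps_X ^ (5 * n + 2) * indef_theta n)"
    by (rule fps_summable_nat[OF refl, of _ 0]) simp
  ultimately show ?thesis
    unfolding fps_Sum_int[OF summable_indef_term] 1 2 by (simp add: fps_Sum_add ring_distribs)
qed

section \<open>Specialisation at w = q\<close>

lemma theta_times_indef_term:
  assumes "N \<ge> \<bar>i\<bar>" "N \<ge> \<bar>m\<bar>"
  shows "qexp (2 * N) * (theta_term (-1) 1 6 i * indef_term m) =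
    qexp (2 * N + (i + m)) * (alt_theta i * indef_coeff m)"
proof -
  have "0 \<le> i + 6 * tri i"
  proof -
    have "i + 6 * tri i = i + 3 * (i * (i - 1))" using double_tri[of i] by simp
    also have "\<dots> = i * (3 * i - 2)" by (simp add: algebra_simps)
    also have "\<dots> \<ge> 0" by (cases "i \<ge> 1") (auto simp: zero_le_mult_iff)
    finally show ?thesis .
  qed
  hence t: "qexp N * theta_term (-1) 1 6 i = qexp (N + i) * alt_theta i"
    unfolding theta_term_neg1 alt_theta_eq mult.assoc[symmetric]
    using assms by (simp add: qexp_mult add.assoc)
  have u: "qexp N * indef_term m = qexp (N + m) * indef_coeff m"
  proof (cases "m \<ge> 0")
    case True
    hence "qexp N * qexp m = qexp (N + m)" using assms by (simp add: qexp_mult)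
    thus ?thesis using True
      by (simp add: indef_term_def indef_coeff_def mult.assoc[symmetric] flip: qexp_def)
  next
    case False
    hence "qexp N * qexp (- 5 * m - 3) = qexp (N + m) * qexp (3 * (- 2 * m - 1))"
      using assms by (simp add: qexp_mult algebra_simps)
    thus ?thesis using False
      by (simp add: indef_term_def indef_coeff_def mult.assoc[symmetric] flip: qexp_def)
  qed
  have e: "qexp (2 * N) = qexp N * qexp N" "qexp (2 * N + (i + m)) = qexp (N + i) * qexp (N + m)"
    using assms by (simp_all add: qexp_mult algebra_simps)
  have "qexp (2 * N) * (theta_term (-1) 1 6 i * indef_term m) =
      (qexp N * theta_term (-1) 1 6 i) * (qexp N * indef_term m)"
    unfolding e by (simp only: mult_ac)
  thus ?thesis unfolding t u e by (simp only: mult_ac)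
qed

lemma Sum_theta_times_indef_term:
  "fps_Sum (\<lambda>i. theta_term (-1) 1 6 i * indef_term (k - i)) = theta_term 1 1 3 k * conv_coeff 0"
proof -
  have nz: "0 \<le> k + 3 * tri k"
  proof -
    have "2 * (k + 3 * tri k) = k * (3 * k - 1)" using double_tri[of k] by (simp add: algebra_simps)
    also have "\<dots> \<ge> 0" by (cases "k \<ge> 1") (auto simp: zero_le_mult_iff)
    finally show ?thesis by simp
  qed
  show ?thesis
  proof (cases "k \<ge> 0")
    case True
    have "theta_term (-1) 1 6 i * indef_term (k - i) = qexp k * (alt_theta i * indef_coeff (k - i))" for i
    proof -
      \<comment> \<open>\<open>q^(2N)\<close> absorbs the possibly negative exponents
        \<open>i\<close> and \<open>k - i\<close>, and is cancelled afterwards.\<close>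
      define N where "N = \<bar>i\<bar> + \<bar>k - i\<bar>"
      have "qexp (2 * N + k) = qexp (2 * N) * qexp k"
        using True by (simp add: N_def qexp_mult)
      hence "qexp (2 * N) * (theta_term (-1) 1 6 i * indef_term (k - i)) =
          qexp (2 * N) * (qexp k * (alt_theta i * indef_coeff (k - i)))"
        using theta_times_indef_term[of i N "k - i"] by (simp add: N_def mult.assoc)
      thus ?thesis by simp
    qed
    hence "fps_Sum (\<lambda>i. theta_term (-1) 1 6 i * indef_term (k - i)) = qexp k * conv_coeff k"
      unfolding conv_coeff_def by (simp add: fps_Sum_mult_left summable_alt_theta_mult)
    also have "\<dots> = qexp k * qexp (3 * tri k) * conv_coeff 0" by (simp add: conv_coeff_eq[of k] mult.assoc)
    finally show ?thesis using True by (simp add: theta_term_1 qexp_mult)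
  next
    case False
    \<comment> \<open>For negative \<open>k\<close> the factor \<open>q^k\<close> is moved to the
      other side as \<open>q^(-k)\<close> and cancelled once the sum is known.\<close>
    have eq: "qexp (- k) * (theta_term (-1) 1 6 i * indef_term (k - i)) = alt_theta i * indef_coeff (k - i)" for i
    proof -
      define N where "N = \<bar>i\<bar> + \<bar>k - i\<bar>"
      have "2 * N + k \<ge> 0" by (auto simp: N_def abs_if)
      hence "qexp (2 * N) = qexp (2 * N + k) * qexp (- k)"
        using False by (simp add: qexp_mult)
      hence "qexp (2 * N + k) * (qexp (- k) * (theta_term (-1) 1 6 i * indef_term (k - i))) =
          qexp (2 * N + k) * (alt_theta i * indef_coeff (k - i))"
        using theta_times_indef_term[of i N "k - i"] by (simp add: N_def mult.assoc)
      thus ?thesis by simp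
    qed
    have "fps_summable (\<lambda>i. theta_term (-1) 1 6 i * indef_term (k - i))"
    proof -
      have "fps_summable (theta_term (-1) 1 6)" by (rule jacobi_triple_product) auto
      from fps_summable_mult_Pair[OF this summable_indef_term]
      have "fps_summable (\<lambda>(i, m). theta_term (-1) 1 6 i * indef_term m)" .
      from fps_summable_reindex[OF _ this, of "\<lambda>i. (i, k - i)"] show ?thesis
        by (simp add: inj_on_def)
    qed
    from fps_Sum_mult_left[OF this, of "qexp (- k)"]
    have "qexp (- k) * fps_Sum (\<lambda>i. theta_term (-1) 1 6 i * indef_term (k - i)) = conv_coeff k"
      unfolding eq conv_coeff_def ..
    also have "\<dots> = qexp (- k) * (theta_term 1 1 3 k * conv_coeff 0)"
    proof -
      have "qexp (3 * tri k) = qexp (- k) * theta_term 1 1 3 k"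
        using False nz by (simp add: theta_term_1 qexp_mult)
      thus ?thesis by (simp add: conv_coeff_eq[of k] mult.assoc)
    qed
    finally show ?thesis by simp
  qed
qed

lemma Sum_indef_term_times_theta:
  "fps_Sum (theta_term (-1) 1 6) * fps_Sum indef_term = fps_Sum (theta_term 1 1 3) * conv_coeff 0"
proof -
  have th: "fps_summable (theta_term (-1) 1 6)" "fps_summable (theta_term 1 1 3)"
    by (rule jacobi_triple_product; simp)+
  have bij: "bij (\<lambda>k :: int. k - i)" for i by (rule o_bij[of "\<lambda>k. k + i"]) auto
  have si: "fps_summable (\<lambda>k. indef_term (k - i))" for i
    by (rule fps_summable_reindex[OF _ summable_indef_term]) (use bij in \<open>simp add: bij_def\<close>)
  have s: "fps_summable (\<lambda>(i, k). theta_term (-1) 1 6 i * indef_term (k - i))"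
    by (rule fps_summable_mult_Pair[OF th(1) si])
  have "fps_Sum (theta_term (-1) 1 6) * fps_Sum indef_term =
      fps_Sum (\<lambda>i. theta_term (-1) 1 6 i * fps_Sum indef_term)"
    by (rule fps_Sum_mult_right[symmetric]) (rule th)
  also have "(\<lambda>i. theta_term (-1) 1 6 i * fps_Sum indef_term) =
      (\<lambda>i. fps_Sum (\<lambda>k. theta_term (-1) 1 6 i * indef_term (k - i)))"
  proof
    fix i
    show "theta_term (-1) 1 6 i * fps_Sum indef_term =
        fps_Sum (\<lambda>k. theta_term (-1) 1 6 i * indef_term (k - i))"
      unfolding fps_Sum_mult_left[OF si] fps_Sum_reindex_bij[OF bij, of indef_term] ..
  qed
  also have "fps_Sum \<dots> = fps_Sum (\<lambda>k. fps_Sum (\<lambda>i. theta_term (-1) 1 6 i * indef_term (k - i)))"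
    by (rule fps_Sum_swap[OF s])
  also have "\<dots> = fps_Sum (theta_term 1 1 3) * conv_coeff 0"
    unfolding Sum_theta_times_indef_term by (rule fps_Sum_mult_right[OF th(2)])
  finally show ?thesis .
qed

text \<open>
  The coefficients \<open>indef_coeff k\<close> tend to 2 as \<open>k\<close> grows, so the order of summation cannot be
  exchanged at \<open>w = 1\<close>. Since \<open>alt_theta\<close> sums to 0, subtracting \<open>step k\<close> changes nothing in
  \<open>conv_coeff k\<close> and restores convergence.
\<close>

definition step :: "int \<Rightarrow> int fps" where
  "step k = (if k > 0 then 2 else if k = 0 then 1 else 0)"

section \<open>Specialisation at w = 1\<close>

lemma finite_step_diff: "finite {k. step (k - i) - step k \<noteq> 0}"
  by (rule finite_subset[of _ "{-\<bar>i\<bar>..\<bar>i\<bar>}"]) (auto simp: step_def split: if_splits)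

lemma summable_step_diff: "fps_summable (\<lambda>k. step (k - i) - step k)"
  by (rule fps_summable_finite) (rule finite_step_diff)

text \<open>Shifting a jump of height 2 by one place changes the sum by -2; the general shift
  telescopes.\<close>

lemma Sum_step_diff: "fps_Sum (\<lambda>k. step (k - i) - step k) = of_int (- 2 * i)"
proof -
  define D where "D i = fps_Sum (\<lambda>k. step (k - i) - step k)" for i
  have "D 1 = (\<Sum>k\<in>{0, 1}. step (k - 1) - step k)"
    unfolding D_def by (rule fps_Sum_finite) (auto simp: step_def)
  hence D1: "D 1 = - 2" by (simp add: step_def)
  have D_add: "D (i + 1) = D i - 2" for i
  proof -
    have bij: "bij (\<lambda>k :: int. k - i)" by (rule o_bij[of "\<lambda>k. k + i"]) auto
    have 1: "fps_summable (\<lambda>k. step (k - i - 1) - step (k - i))"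
      using fps_summable_reindex[OF _ summable_step_diff[of 1], of "\<lambda>k. k - i"] by (simp add: inj_on_def)
    have "D (i + 1) = fps_Sum (\<lambda>k. (step (k - i) - step k) + (step (k - i - 1) - step (k - i)))"
      unfolding D_def by (simp add: algebra_simps)
    also have "\<dots> = D i + fps_Sum (\<lambda>k. step (k - i - 1) - step (k - i))"
      unfolding D_def by (rule fps_Sum_add[OF summable_step_diff 1])
    also have "fps_Sum (\<lambda>k. step (k - i - 1) - step (k - i)) = D 1"
      unfolding D_def using fps_Sum_reindex_bij[OF bij, of "\<lambda>k. step (k - 1) - step k"] by simp
    finally show ?thesis using D1 by simp
  qed
  have "D i = of_int (- 2 * i)"
  proof (induction i rule: int_induct[of _ 0])
    case base
    show ?case by (simp add: D_def)
  next
    case (step1 i)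
    thus ?case using D_add[of i] by simp
  next
    case (step2 i)
    thus ?case using D_add[of "i - 1"] by (simp add: algebra_simps)
  qed
  thus ?thesis by (simp add: D_def)
qed

lemma summable_indef_coeff_diff: "fps_summable (\<lambda>k. indef_coeff k - step k)"
  and Sum_indef_coeff_diff: "fps_Sum (\<lambda>k. indef_coeff k - step k) = 0"
proof -
  define d where "d k = indef_coeff k - step k" for k
  \<comment> \<open>The value 1 of \<open>step\<close> at 0 gives
    \<open>step k + step (- k) = 2\<close>, matching \<open>indef_coeff_reflect\<close>. Hence
    \<open>d\<close> is odd and its sum equals its own negative.\<close>
  have neg: "d (- k) = - d k" for k
    unfolding d_def indef_coeff_reflect by (auto simp: step_def)
  show s: "fps_summable (\<lambda>k. indef_coeff k - step k)"
    unfolding d_def[symmetric]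
  proof (rule fps_summable_int)
    define g where "g k = (if k = 0 then 0 else if k > 0 then - indef_theta (nat (k - 1)) else indef_theta (nat (- k - 1)))" for k :: int
    have m: "d k = qexp (3 * (2 * \<bar>k\<bar> - 1)) * g k" if "k < 0" for k
      using that by (simp add: d_def g_def step_def indef_coeff_def)
    show "d k = fps_X ^ nat (3 * (2 * \<bar>k\<bar> - 1)) * g k" for k
    proof -
      consider "k < 0" | "k = 0" | "k > 0" by linarith
      thus ?thesis
      proof cases
        case 1
        thus ?thesis using m by (simp add: qexp_def)
      next
        case 2
        thus ?thesis by (simp add: d_def g_def step_def indef_coeff_def indef_theta_0)
      next
        case 3
        have "g k = - g (- k)" using 3 by (simp add: g_def)
        moreover have "d k = - d (- k)" using neg[of k] by simp
        ultimately show ?thesis using 3 m[of "- k"] by (simp add: qexp_def)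
      qed
    qed
    show "\<bar>k\<bar> \<le> int (nat (3 * (2 * \<bar>k\<bar> - 1))) + 0" for k :: int
      by (cases "k = 0") auto
  qed
  have "bij (uminus :: int \<Rightarrow> int)" by (rule o_bij[of uminus]) auto
  from fps_Sum_reindex_bij[OF this, of d] have "- fps_Sum d = fps_Sum d"
    by (simp add: neg fps_Sum_minus)
  hence "- fps_nth (fps_Sum d) n = fps_nth (fps_Sum d) n" for n
    by (metis fps_neg_nth)
  hence "fps_Sum d = 0" by (intro fps_ext) simp
  thus "fps_Sum (\<lambda>k. indef_coeff k - step k) = 0" by (simp add: d_def[abs_def])
qed

text \<open>Near \<open>w = 1\<close>, \<open>U\<close> behaves like \<open>2 / (1 - w)\<close>, so
  the product with the theta series \<open>j\<close> takes the value \<open>- 2 j'(1)\<close>, the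
  sum of \<open>- 2 i\<close> times \<open>alt_theta i\<close>.\<close>

lemma Sum_conv_coeff: "fps_Sum conv_coeff = fps_Sum (\<lambda>i. alt_theta i * of_int (- 2 * i))"
proof -
  have eq: "conv_coeff k = fps_Sum (\<lambda>i. alt_theta i * (indef_coeff (k - i) - step k))" for k
  proof -
    have "fps_Sum (\<lambda>i. alt_theta i * (indef_coeff (k - i) - step k)) =
        conv_coeff k - fps_Sum (\<lambda>i. alt_theta i * step k)"
      unfolding conv_coeff_def right_diff_distrib by (intro fps_Sum_diff summable_alt_theta_mult)
    thus ?thesis by (simp add: fps_Sum_mult_right summable_alt_theta Sum_alt_theta)
  qed
  have bij: "bij (\<lambda>k :: int. k - i)" for i by (rule o_bij[of "\<lambda>k. k + i"]) auto
  have split: "(\<lambda>k. indef_coeff (k - i) - step k) =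
      (\<lambda>k. (indef_coeff (k - i) - step (k - i)) + (step (k - i) - step k))" for i
    by simp
  have s1: "fps_summable (\<lambda>k. indef_coeff (k - i) - step (k - i))" for i
    using fps_summable_reindex[OF _ summable_indef_coeff_diff, of "\<lambda>k. k - i"] by (simp add: inj_on_def)
  have s: "fps_summable (\<lambda>k. indef_coeff (k - i) - step k)" for i
    unfolding split by (intro fps_summable_add s1 summable_step_diff)
  have inner: "fps_Sum (\<lambda>k. indef_coeff (k - i) - step k) = of_int (- 2 * i)" for i
    unfolding split fps_Sum_add[OF s1 summable_step_diff] Sum_step_diff
    using fps_Sum_reindex_bij[OF bij[of i], of "\<lambda>k. indef_coeff k - step k"]
    by (simp add: Sum_indef_coeff_diff)
  have "fps_Sum conv_coeff = fps_Sum (\<lambda>k. fps_Sum (\<lambda>i. alt_theta i * (indef_coeff (k - i) - step k)))"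
    by (simp add: eq[abs_def])
  also have "\<dots> = fps_Sum (\<lambda>i. fps_Sum (\<lambda>k. alt_theta i * (indef_coeff (k - i) - step k)))"
    by (rule fps_Sum_swap[symmetric]) (intro fps_summable_mult_Pair summable_alt_theta s)
  also have "\<dots> = fps_Sum (\<lambda>i. alt_theta i * of_int (- 2 * i))"
    by (simp only: fps_Sum_mult_left[OF s] inner)
  finally show ?thesis .
qed

text \<open>The terms \<open>i = n + 1\<close> and \<open>i = - n\<close> have equal exponents, and
  their weights add up to a multiple of \<open>2 n + 1\<close>: the derivative of theta becomes
  Jacobi's cube.\<close>

lemma conv_coeff_0: "conv_coeff 0 * fps_Sum (theta_term 1 0 3) = 2 * qprod (-1) 6 6 ^ 3"
proof -
  define J :: "nat \<Rightarrow> int fps" where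
    "J j = fps_X ^ (6 * (Suc j choose 2)) * (of_nat (2 * j + 1) * (-1) ^ j)" for j
  have J: "fps_summable J" "fps_Sum J = qprod (-1) 6 6 ^ 3"
    unfolding J_def[abs_def] by (rule jacobi_cube; simp)+
  have th: "fps_summable (theta_term 1 0 3)" by (rule jacobi_triple_product) auto
  have "conv_coeff = (\<lambda>k. theta_term 1 0 3 k * conv_coeff 0)"
    by (rule ext) (subst conv_coeff_eq, simp add: theta_term_1)
  hence "conv_coeff 0 * fps_Sum (theta_term 1 0 3) = fps_Sum conv_coeff"
    using fps_Sum_mult_right[OF th, of "conv_coeff 0"] by (simp add: mult.commute)
  also have "\<dots> = fps_Sum (\<lambda>i. alt_theta i * of_int (- 2 * i))" by (rule Sum_conv_coeff)
  also have "\<dots> = fps_Sum (\<lambda>n. alt_theta (int n) * of_int (- 2 * int n)) +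
      fps_Sum (\<lambda>n. alt_theta (- 1 - int n) * of_int (- 2 * (- 1 - int n)))"
    by (rule fps_Sum_int) (rule summable_alt_theta_mult)
  also have "\<dots> = 2 * fps_Sum J"
  proof -
    \<comment> \<open>\<open>G n\<close> is the contribution of \<open>i = - n\<close>. As
      \<open>G 0 = 0\<close>, the sum may start at 0 or at 1, which aligns the two halves.\<close>
    define G :: "nat \<Rightarrow> int fps" where
      "G n = fps_X ^ (6 * (Suc n choose 2)) * ((-1) ^ n * of_nat (2 * n))" for n
    have le: "n \<le> 6 * (Suc n choose 2) + 0" for n by (simp add: Suc_choose_two)
    have sG: "fps_summable G" by (rule fps_summable_nat[OF _ le]) (simp add: G_def)
    have a1: "alt_theta (int n) = fps_X ^ (6 * (n choose 2)) * (-1) ^ n" for n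
      by (simp add: alt_theta_def theta_term_nonneg)
    have a2: "alt_theta (- 1 - int n) = fps_X ^ (6 * (Suc (Suc n) choose 2)) * (-1) ^ Suc n" for n
    proof -
      have "- 1 - int n = - int (Suc n)" by simp
      moreover have "(6 - 0) * Suc n + 6 * (Suc n choose 2) = 6 * (Suc (Suc n) choose 2)"
        by (simp add: Suc_choose_two[of "Suc n"])
      moreover have "(0 :: nat) \<le> 6" by simp
      ultimately show ?thesis
        unfolding alt_theta_def using theta_term_nonpos[of 0 6 "-1" "Suc n"] by metis
    qed
    have "fps_Sum (\<lambda>n. alt_theta (int n) * of_int (- 2 * int n)) =
        fps_Sum (\<lambda>n. alt_theta (int (Suc n)) * of_int (- 2 * int (Suc n)))"
    proof -
      have "fps_summable (\<lambda>n. alt_theta (int n) * of_int (- 2 * int n))"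
        by (rule fps_summable_reindex[of int "\<lambda>i. alt_theta i * of_int (- 2 * i)"])
          (simp, rule summable_alt_theta_mult)
      from fps_Sum_Suc[OF this] show ?thesis
        by (simp only: of_nat_0 mult_zero_right of_int_0 add_0)
    qed
    also have "(\<lambda>n. alt_theta (int (Suc n)) * of_int (- 2 * int (Suc n))) = (\<lambda>n. 2 * J n - G n)"
      unfolding a1 by (rule ext) (simp add: J_def G_def algebra_simps)
    also have "fps_Sum \<dots> = 2 * fps_Sum J - fps_Sum G"
      unfolding fps_Sum_diff[OF fps_summable_mult_left[OF J(1)] sG] fps_Sum_mult_left[OF J(1)] ..
    finally have 1: "fps_Sum (\<lambda>n. alt_theta (int n) * of_int (- 2 * int n)) = 2 * fps_Sum J - fps_Sum G" .
    have "fps_Sum (\<lambda>n. alt_theta (- 1 - int n) * of_int (- 2 * (- 1 - int n))) = fps_Sum (\<lambda>n. G (Suc n))"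
      unfolding a2 by (rule arg_cong[of _ _ fps_Sum], rule ext) (simp add: G_def algebra_simps)
    also have "fps_Sum (\<lambda>n. G (Suc n)) = fps_Sum G"
      using fps_Sum_Suc[OF sG] by (simp add: G_def)
    finally show ?thesis unfolding 1 by simp
  qed
  finally show ?thesis using J(2) by simp
qed

section \<open>The eta quotient and its residue modulo 8\<close>

lemma qprod_nonzero:
  assumes "a > 0" "b > 0"
  shows "qprod s a b \<noteq> 0"
proof
  assume "qprod s a b = 0"
  hence "fps_X ^ 1 dvd (0 - 1 :: int fps)" using qprod_dvd[of b 1 a s] assms by simp
  thus False unfolding X_power_dvd_iff by (auto dest!: spec[of _ 0])
qed

text \<open>The elimination alone, without series. \<open>F\<close> is the trisected series and
  \<open>v\<close> is \<open>conv_coeff 0\<close>; \<open>E1\<close>, \<open>E2\<close>,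
  \<open>E3\<close>, \<open>E6\<close> are the products \<open>(q^k; q^k)\<close>; \<open>a\<close>,
  \<open>c\<close>, \<open>b\<close> are \<open>(q; q^6)\<close>, \<open>(q^3; q^6)\<close>,
  \<open>(q^5; q^6)\<close>; and \<open>p\<close>, \<open>r\<close>, \<open>t\<close> are
  \<open>(-q; q^3)\<close>, \<open>(-q^2; q^3)\<close>, \<open>(-q^3; q^3)\<close>. The unknown
  turns out to be \<open>v = E6 * E3\<close>.\<close>

lemma theta_quotient_cancel:
  fixes F a b c p r t v E1 E2 E3 E6 :: "'a :: {idom, semiring_char_0}"
  assumes "F * E2 * (a * b * E6) = p * r * E3 * v" "v * (2 * t * t * E3) = 2 * E6 ^ 3"
    "t * E3 = E6" "p * r * t * E1 = E2" "E1 = a * c * b * E2" "E3 = c * E6"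
    and nz: "E1 \<noteq> 0" "E2 \<noteq> 0" "E3 \<noteq> 0" "E6 \<noteq> 0" "t \<noteq> 0"
  shows "F * ((a * c * b) ^ 2 * E2) = (c ^ 2 * E6) ^ 2"
proof -
  have "2 * t * E6 * (v - E6 * E3) = v * (2 * t * t * E3) - 2 * E6 ^ 3"
    unfolding assms(3)[symmetric] by (simp add: algebra_simps power3_eq_cube)
  hence v: "v = E6 * E3" using nz assms(2) by simp
  have "E6 * E2 * (F * (a * b) * t * E1 - E3 ^ 2) =
      F * E2 * (a * b * E6) * (t * E1) - E6 * E2 * E3 ^ 2"
    by (simp add: algebra_simps)
  also have "F * E2 * (a * b * E6) * (t * E1) = (p * r * t * E1) * E3 * v"
    unfolding assms(1) by (simp only: mult_ac)
  also have "\<dots> - E6 * E2 * E3 ^ 2 = 0"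
    unfolding assms(4) v by (simp add: power2_eq_square)
  finally have 1: "F * (a * b) * t * E1 = E3 ^ 2" using nz by simp
  have "c * E6 * (F * (a * b) ^ 2 * E2 - c ^ 2 * E6 ^ 2) =
      F * (a * b) * E6 * (a * c * b * E2) - (c * E6) ^ 3"
    by (simp add: algebra_simps power2_eq_square power3_eq_cube)
  also have "F * (a * b) * E6 * (a * c * b * E2) = (F * (a * b) * t * E1) * E3"
    unfolding assms(3)[symmetric] assms(5)[symmetric] by (simp only: mult_ac)
  also have "\<dots> - (c * E6) ^ 3 = 0"
    unfolding 1 assms(6)[symmetric] by (simp add: power2_eq_square power3_eq_cube)
  finally have "F * (a * b) ^ 2 * E2 = c ^ 2 * E6 ^ 2" using assms(6) nz by auto
  hence "c ^ 2 * (F * (a * b) ^ 2 * E2) = c ^ 2 * (c ^ 2 * E6 ^ 2)" by simp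
  thus ?thesis by (simp add: power2_eq_square mult_ac)
qed

theorem trisect_xi_theta_quotient:
  "trisect xi * (qprod (-1) 1 2 ^ 2 * qprod (-1) 2 2) = (qprod (-1) 3 6 ^ 2 * qprod (-1) 6 6) ^ 2"
proof -
  have m: "qprod (-1) 1 2 = qprod (-1) 1 6 * qprod (-1) 3 6 * qprod (-1) 5 6"
  proof -
    have e: "(1 :: nat) + 2 = 3" "(1 :: nat) + 2 * 2 = 5" "(3 :: nat) * 2 = 6" by simp_all
    show ?thesis using qprod_split3[of 2 "-1" 1] unfolding e by simp
  qed
  have j1: "fps_Sum (theta_term (-1) 1 6) = qprod (-1) 1 6 * qprod (-1) 5 6 * qprod (-1) 6 6"
    using jacobi_triple_product(2)[of 6 1 "-1"] by simp
  have j2: "fps_Sum (theta_term 1 1 3) = qprod 1 1 3 * qprod 1 2 3 * qprod (-1) 3 3"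
    using jacobi_triple_product(2)[of 3 1 1] by simp
  \<comment> \<open>The factor with exponent 0 is \<open>1 + 1 = 2\<close>; it later cancels the 2
    from the pole of \<open>U\<close>.\<close>
  have "qprod 1 0 3 = 2 * qprod 1 3 3" by (subst qprod_rec) simp_all
  hence j3: "fps_Sum (theta_term 1 0 3) = 2 * qprod 1 3 3 * qprod 1 3 3 * qprod (-1) 3 3"
    using jacobi_triple_product(2)[of 3 0 1] by simp
  have "trisect xi * qprod (-1) 2 2 * (qprod (-1) 1 6 * qprod (-1) 5 6 * qprod (-1) 6 6) =
      qprod 1 1 3 * qprod 1 2 3 * qprod (-1) 3 3 * conv_coeff 0"
    unfolding trisect_xi(2) Sum_indef_term[symmetric] j1[symmetric] j2[symmetric]
    using Sum_indef_term_times_theta by (simp only: mult.commute)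
  moreover have "conv_coeff 0 * (2 * qprod 1 3 3 * qprod 1 3 3 * qprod (-1) 3 3) = 2 * qprod (-1) 6 6 ^ 3"
    using conv_coeff_0 unfolding j3 .
  moreover have "qprod 1 3 3 * qprod (-1) 3 3 = qprod (-1) 6 6"
    using qprod_mult_neg[of 3 1 3] by simp
  moreover have "qprod 1 1 3 * qprod 1 2 3 * qprod 1 3 3 * qprod (-1) 1 1 = qprod (-1) 2 2"
  proof -
    have e: "(1 :: nat) + 1 = 2" "(1 :: nat) + 2 * 1 = 3" "(3 :: nat) * 1 = 3" by simp_all
    show ?thesis using qprod_split3[of 1 1 1] qprod_mult_neg[of 1 1 1] unfolding e by simp
  qed
  moreover have "qprod (-1) 1 1 = qprod (-1) 1 6 * qprod (-1) 3 6 * qprod (-1) 5 6 * qprod (-1) 2 2"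
  proof -
    have e: "(1 :: nat) + 1 = 2" "(2 :: nat) * 1 = 2" by simp_all
    show ?thesis using qprod_split2[of 1 "-1" 1, OF zero_less_one] unfolding e m .
  qed
  moreover have "qprod (-1) 3 3 = qprod (-1) 3 6 * qprod (-1) 6 6"
    using qprod_split2[of 3 "-1" 3] by simp
  ultimately show ?thesis
    unfolding m by (rule theta_quotient_cancel) (auto simp: qprod_nonzero)
qed

text \<open>\<open>1 + 2 * alt_squares c\<close> is \<open>\<phi>(-q\<^sup>c)\<close>.\<close>

definition alt_squares :: "nat \<Rightarrow> int fps" where
  "alt_squares c = fps_Sum (\<lambda>n. fps_X ^ (c * Suc n ^ 2) * (-1) ^ Suc n)"

lemma phi_alt_squares:
  assumes "c > 0"
  shows "qprod (-1) c (2 * c) ^ 2 * qprod (-1) (2 * c) (2 * c) = 1 + 2 * alt_squares c"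
proof -
  define f :: "nat \<Rightarrow> int fps" where "f n = fps_X ^ (c * n ^ 2) * (-1) ^ n" for n
  have "n \<le> c * n ^ 2 + 0" for n
  proof -
    have "n \<le> n ^ 2" by (simp add: power2_nat_le_imp_le)
    also have "\<dots> \<le> c * n ^ 2" using assms by simp
    finally show ?thesis by simp
  qed
  hence f: "fps_summable f"
    by (intro fps_summable_nat[of f "\<lambda>n. c * n ^ 2" "\<lambda>n. (-1) ^ n" 0]) (auto simp: f_def)
  have th: "fps_summable (theta_term (-1) c (2 * c))"
    "fps_Sum (theta_term (-1) c (2 * c)) = qprod (-1) c (2 * c) ^ 2 * qprod (-1) (2 * c) (2 * c)"
    using jacobi_triple_product[of "2 * c" c "-1"] assms by (simp_all add: power2_eq_square)
  have e: "c * n + 2 * c * (n choose 2) = c * n ^ 2" for n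
    using double_choose_two[of n] by (metis add_mult_distrib2 mult.assoc mult.left_commute power2_eq_square)
  have "theta_term (-1) c (2 * c) (int n) = f n" for n
    unfolding theta_term_nonneg e f_def ..
  moreover have "theta_term (-1) c (2 * c) (- 1 - int n) = f (Suc n)" for n
  proof -
    have "- 1 - int n = - int (Suc n)" by simp
    moreover have "2 * c - c = c" by simp
    moreover have "c \<le> 2 * c" by simp
    ultimately show ?thesis using theta_term_nonpos[of c "2 * c" "-1" "Suc n"] e[of "Suc n"]
      unfolding f_def by metis
  qed
  ultimately have "fps_Sum (theta_term (-1) c (2 * c)) = fps_Sum f + fps_Sum (\<lambda>n. f (Suc n))"
    unfolding fps_Sum_int[OF th(1)] by simp
  also have "fps_Sum f = 1 + fps_Sum (\<lambda>n. f (Suc n))"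
    using fps_Sum_Suc[OF f] by (simp add: f_def)
  also have "fps_Sum (\<lambda>n. f (Suc n)) = alt_squares c"
    unfolding alt_squares_def f_def ..
  finally show ?thesis unfolding th(2) by simp
qed

lemma alt_squares_nth:
  assumes "c > 0" "k \<ge> 1"
  shows "fps_nth (alt_squares c) (c * k ^ 2) = (-1) ^ k"
proof -
  obtain j where k: "k = Suc j" using assms(2) by (cases k) auto
  have "fps_nth (alt_squares c) (c * k ^ 2) =
      (\<Sum>i\<in>{j}. fps_nth (fps_X ^ (c * Suc i ^ 2) * (-1) ^ Suc i) (c * k ^ 2))"
    unfolding alt_squares_def
  proof (rule fps_Sum_nth)
    show "i \<in> {j}" if "fps_nth (fps_X ^ (c * Suc i ^ 2) * (-1) ^ Suc i :: int fps) (c * k ^ 2) \<noteq> 0" for i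
    proof (cases "even (Suc i)")
      case True
      hence "c * k ^ 2 = c * Suc i ^ 2" using that by (simp split: if_splits)
      thus ?thesis using assms(1) k by (simp add: power2_eq_iff_nonneg)
    next
      case False
      hence "c * k ^ 2 = c * Suc i ^ 2" using that by (simp split: if_splits)
      thus ?thesis using assms(1) k by (simp add: power2_eq_iff_nonneg)
    qed
  qed simp
  also have "\<dots> = (-1) ^ k"
    by (cases "even k") (simp_all add: k)
  finally show ?thesis .
qed

lemma alt_squares_nth_eq_0:
  assumes "\<not> (\<exists>k\<ge>1. n = c * k ^ 2)"
  shows "fps_nth (alt_squares c) n = 0"
  unfolding alt_squares_def
proof (rule fps_Sum_nth_0)
  fix i
  have "n \<noteq> c * Suc i ^ 2" using assms by (metis le_add1 plus_1_eq_Suc)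
  thus "fps_nth (fps_X ^ (c * Suc i ^ 2) * (-1) ^ Suc i :: int fps) n = 0"
    by (cases "even (Suc i)") simp_all
qed

text \<open>Pairing \<open>i\<close> with \<open>n - i\<close> leaves only the middle term modulo 2,
  and an integer has the parity of its square.\<close>

lemma even_square_nth:
  fixes f :: "int fps"
  shows "even (fps_nth (f ^ 2) n - (if even n then fps_nth f (n div 2) else 0))"
proof -
  define g where "g i = fps_nth f i * fps_nth f (n - i)" for i
  define L U D where "L = {i. i \<le> n \<and> 2 * i < n}" and "U = {i. i \<le> n \<and> 2 * i > n}"
    and "D = {i. i \<le> n \<and> 2 * i = n}"
  have fin: "finite L" "finite U" "finite D" by (simp_all add: L_def U_def D_def)
  have "sum g U = sum g L"
    by (rule sum.reindex_bij_witness[of _ "\<lambda>i. n - i" "\<lambda>i. n - i"])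
      (auto simp: L_def U_def g_def mult.commute)
  have "fps_nth (f ^ 2) n = sum g {0..n}"
    by (simp add: power2_eq_square fps_mult_nth g_def)
  also have "{0..n} = (L \<union> U) \<union> D" by (auto simp: L_def U_def D_def)
  also have "sum g \<dots> = sum g (L \<union> U) + sum g D"
    by (rule sum.union_disjoint) (use fin in \<open>auto simp: L_def U_def D_def\<close>)
  also have "sum g (L \<union> U) = sum g L + sum g U"
    by (rule sum.union_disjoint) (use fin in \<open>auto simp: L_def U_def\<close>)
  also have "sum g D = (if even n then fps_nth f (n div 2) ^ 2 else 0)"
  proof (cases "even n")
    case True
    hence "D = {n div 2}" by (auto simp: D_def)
    moreover have "n - n div 2 = n div 2" using True by (auto elim!: evenE)
    ultimately show ?thesis using True by (simp add: g_def power2_eq_square)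
  next
    case False
    hence "D = {}" by (auto simp: D_def)
    thus ?thesis using False by simp
  qed
  finally have "fps_nth (f ^ 2) n = 2 * sum g L + (if even n then fps_nth f (n div 2) ^ 2 else 0)"
    using \<open>sum g U = sum g L\<close> by simp
  thus ?thesis by (auto simp: power2_eq_square)
qed

lemma odd_alt_squares_nth: "c > 0 \<Longrightarrow> odd (fps_nth (alt_squares c) n) \<longleftrightarrow> (\<exists>k\<ge>1. n = c * k ^ 2)"
  using alt_squares_nth alt_squares_nth_eq_0 by (cases "\<exists>k\<ge>1. n = c * k ^ 2") force+

lemma odd_alt_squares_square_nth:
  assumes "c > 0"
  shows "odd (fps_nth (alt_squares c ^ 2) n) \<longleftrightarrow> (\<exists>k\<ge>1. n = 2 * c * k ^ 2)"
proof -
  have "odd (fps_nth (alt_squares c ^ 2) n) \<longleftrightarrow> even n \<and> odd (fps_nth (alt_squares c) (n div 2))"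
    using even_square_nth[of "alt_squares c" n] by (auto split: if_splits)
  also have "\<dots> \<longleftrightarrow> even n \<and> (\<exists>k\<ge>1. n div 2 = c * k ^ 2)"
    using odd_alt_squares_nth[OF assms] by simp
  also have "\<dots> \<longleftrightarrow> (\<exists>k\<ge>1. n = 2 * c * k ^ 2)"
    by (auto elim!: evenE)
  finally show ?thesis .
qed

theorem p_xi_mod_8:
  "[p_xi (3 * n) = (if n = 0 then 1 else 0) - 2 * fps_nth (alt_squares 1) n + 4 * fps_nth (alt_squares 1 ^ 2) n
     + 4 * fps_nth (alt_squares 3) n + 4 * fps_nth (alt_squares 3 ^ 2) n] (mod 8)"
proof -
  define F where "F = trisect xi"
  define A where "A = alt_squares 1"
  define B where "B = alt_squares 3"
  have "F * (1 + 2 * A) = (1 + 2 * B) ^ 2"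
    using trisect_xi_theta_quotient phi_alt_squares[of 1] phi_alt_squares[of 3]
    by (simp add: F_def A_def B_def)
  \<comment> \<open>\<open>G\<close> collects the multiples of 8: the mixed products of the two
    expansions, and the error from \<open>(1 + 2 A) (1 - 2 A + 4 A^2) = 1 + 8 A^3\<close>.\<close>
  define G where "G = (B + B ^ 2) * (2 * A ^ 2 - A) - A ^ 3 * F"
  have "F = F * (1 + 2 * A) * (1 - 2 * A + 4 * A ^ 2) - 8 * A ^ 3 * F"
    by (simp add: algebra_simps power2_eq_square power3_eq_cube)
  also have "F * (1 + 2 * A) = (1 + 2 * B) ^ 2" by fact
  also have "(1 + 2 * B) ^ 2 * (1 - 2 * A + 4 * A ^ 2) - 8 * A ^ 3 * F =
      1 - 2 * A + 4 * A ^ 2 + 4 * B + 4 * B ^ 2 + 8 * G"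
    by (simp add: G_def algebra_simps power2_eq_square power3_eq_cube)
  finally have F: "F = 1 - 2 * A + 4 * A ^ 2 + 4 * B + 4 * B ^ 2 + 8 * G" .
  have num: "fps_nth (numeral m * f) n = numeral m * fps_nth f n" for m and f :: "int fps"
    by (simp add: fps_numeral_fps_const)
  have "p_xi (3 * n) = fps_nth F n" by (simp add: F_def p_xi_def)
  also have "\<dots> = (if n = 0 then 1 else 0) - 2 * fps_nth A n + 4 * fps_nth (A ^ 2) n
     + 4 * fps_nth B n + 4 * fps_nth (B ^ 2) n + 8 * fps_nth G n"
    by (subst F) (simp only: fps_add_nth fps_sub_nth num fps_one_nth)
  finally show ?thesis unfolding A_def B_def by (simp add: cong_def)
qed

section \<open>Disjointness of the square classes and the case distinction\<close>

lemma square_ratio: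
  fixes x l e :: nat
  assumes "x ^ 2 = e * l ^ 2" "l > 0"
  shows "\<exists>m. e = m ^ 2"
proof -
  have "l ^ 2 dvd x ^ 2" using assms by simp
  hence "l dvd x" by simp
  then obtain m where "x = l * m" by (elim dvdE)
  thus ?thesis using assms by (auto simp: power_mult_distrib)
qed

text \<open>Multiplying the equation by \<open>c\<close> makes \<open>c d l^2\<close> a square,
  which forces \<open>c d\<close> to be a square.\<close>

lemma square_multiples_disjoint:
  fixes c d k l :: nat
  assumes "c * k ^ 2 = d * l ^ 2" "l \<ge> 1" "\<not> (\<exists>m. c * d = m ^ 2)"
  shows False
proof -
  have "(c * k) ^ 2 = c * (c * k ^ 2)" by (simp add: power2_eq_square)
  also have "\<dots> = (c * d) * l ^ 2" unfolding assms(1) by simp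
  finally show False using square_ratio[of "c * k" "c * d" l] assms by auto
qed

lemma not_square:
  fixes m :: nat
  assumes "a ^ 2 < e" "e < Suc a ^ 2"
  shows "\<not> (\<exists>m. e = m ^ 2)"
proof
  assume "\<exists>m. e = m ^ 2"
  then obtain m where "a ^ 2 < m ^ 2" "m ^ 2 < Suc a ^ 2" using assms by auto
  thus False by (metis less_Suc_eq_le linorder_not_less power_less_imp_less_base zero_le)
qed

theorem theorem4p7:
  fixes n :: nat
  shows "(n = 0 \<longrightarrow> [p_xi (3 * n) = 1] (mod 8))
    \<and> (\<forall>k\<ge>1. n = k ^ 2 \<longrightarrow> [p_xi (3 * n) = 6 * (-1) ^ k] (mod 8))
    \<and> ((\<exists>k\<ge>1. n = 2 * k ^ 2 \<or> n = 3 * k ^ 2 \<or> n = 6 * k ^ 2) \<longrightarrow> [p_xi (3 * n) = 4] (mod 8))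
    \<and> (n \<noteq> 0 \<and> \<not> (\<exists>k\<ge>1. n = k ^ 2 \<or> n = 2 * k ^ 2 \<or> n = 3 * k ^ 2 \<or> n = 6 * k ^ 2)
        \<longrightarrow> [p_xi (3 * n) = 0] (mod 8))"
proof -
  define Q where "Q c \<longleftrightarrow> (\<exists>k\<ge>1. n = c * k ^ 2)" for c
  define a where "a = fps_nth (alt_squares 1) n"
  define a2 where "a2 = fps_nth (alt_squares 1 ^ 2) n"
  define b where "b = fps_nth (alt_squares 3) n"
  define b2 where "b2 = fps_nth (alt_squares 3 ^ 2) n"
  have p: "[p_xi (3 * n) = (if n = 0 then 1 else 0) - 2 * a + 4 * a2 + 4 * b + 4 * b2] (mod 8)"
    unfolding a_def a2_def b_def b2_def by (rule p_xi_mod_8)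
  have par: "odd a2 \<longleftrightarrow> Q 2" "odd b \<longleftrightarrow> Q 3" "odd b2 \<longleftrightarrow> Q 6"
    using odd_alt_squares_square_nth[of 1 n] odd_alt_squares_nth[of 3 n] odd_alt_squares_square_nth[of 3 n]
    by (simp_all add: a2_def b_def b2_def Q_def)
  have a0: "a = 0" if "\<not> Q 1"
    using that alt_squares_nth_eq_0[of n 1] by (simp add: a_def Q_def)
  \<comment> \<open>\<open>r\<close> is the integer square root of \<open>c * d\<close>. The pairs
    from 1, 2, 3, 6 have the products 2, 3, 6, 6, 12, 18, none of them a square.\<close>
  have disj: "\<not> (Q c \<and> Q d)" if "r ^ 2 < c * d" "c * d < Suc r ^ 2" for c d r
    using square_multiples_disjoint[of c _ d] not_square[OF that] unfolding Q_def by metis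
  have d: "\<not> (Q 1 \<and> Q 2)" "\<not> (Q 1 \<and> Q 3)" "\<not> (Q 1 \<and> Q 6)"
      "\<not> (Q 2 \<and> Q 3)" "\<not> (Q 2 \<and> Q 6)" "\<not> (Q 3 \<and> Q 6)"
    using disj[of 1 1 2] disj[of 1 1 3] disj[of 2 1 6] disj[of 2 2 3] disj[of 3 2 6] disj[of 4 3 6]
    by (simp_all add: power2_eq_square)
  have four: "[4 * a2 + 4 * b + 4 * b2 = (if odd (a2 + b + b2) then 4 else 0)] (mod 8)"
  proof -
    obtain s where "a2 + b + b2 = (if odd (a2 + b + b2) then 2 * s + 1 else 2 * s)"
      by (metis evenE oddE)
    hence "4 * a2 + 4 * b + 4 * b2 = (if odd (a2 + b + b2) then 4 else 0) + 8 * s"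
      by (auto split: if_splits)
    thus ?thesis by (simp add: cong_def)
  qed
  have p': "[p_xi (3 * n) = (if n = 0 then 1 else 0) - 2 * a + (if odd (a2 + b + b2) then 4 else 0)] (mod 8)"
    using p cong_add[OF cong_refl[of "(if n = 0 then 1 else 0) - 2 * a"] four]
    by (simp only: add.assoc) (rule cong_trans)
  have Q0: "\<not> Q c" if "n = 0" "c > 0" for c
    using that by (auto simp: Q_def)
  show ?thesis
  proof (intro conjI impI allI)
    assume "n = 0"
    hence "\<not> Q 1" "\<not> Q 2" "\<not> Q 3" "\<not> Q 6" using Q0 by simp_all
    thus "[p_xi (3 * n) = 1] (mod 8)" using p' a0 par \<open>n = 0\<close> by simp
  next
    fix k :: nat assume k: "k \<ge> 1" "n = k ^ 2"
    hence "Q 1" unfolding Q_def by auto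
    hence "\<not> Q 2" "\<not> Q 3" "\<not> Q 6" using d by blast+
    moreover have "a = (-1) ^ k" using k alt_squares_nth[of 1 k] by (simp add: a_def)
    moreover have "n \<noteq> 0" using k by simp
    ultimately have "[p_xi (3 * n) = - 2 * (-1) ^ k] (mod 8)" using p' par by simp
    moreover have "[- 2 * (-1) ^ k = 6 * (-1) ^ k :: int] (mod 8)"
      by (cases "even k") (simp_all add: cong_def)
    ultimately show "[p_xi (3 * n) = 6 * (-1) ^ k] (mod 8)" by (rule cong_trans)
  next
    assume "\<exists>k\<ge>1. n = 2 * k ^ 2 \<or> n = 3 * k ^ 2 \<or> n = 6 * k ^ 2"
    hence Q: "Q 2 \<or> Q 3 \<or> Q 6" unfolding Q_def by blast
    hence "\<not> Q 1" using d by blast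
    \<comment> \<open>By disjointness exactly one of the three summands is odd.\<close>
    moreover have "odd (a2 + b + b2)" using Q d par by auto
    moreover have "n \<noteq> 0" using Q Q0[of 2] Q0[of 3] Q0[of 6] by auto
    ultimately show "[p_xi (3 * n) = 4] (mod 8)" using p' a0 by simp
  next
    assume *: "n \<noteq> 0 \<and> \<not> (\<exists>k\<ge>1. n = k ^ 2 \<or> n = 2 * k ^ 2 \<or> n = 3 * k ^ 2 \<or> n = 6 * k ^ 2)"
    hence "\<not> Q 1" "\<not> Q 2" "\<not> Q 3" "\<not> Q 6" unfolding Q_def by auto
    thus "[p_xi (3 * n) = 0] (mod 8)" using p' a0 par * by simp
  qed
qed

end
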